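(* Let $\mathcal S$ be the set of pairs $(v,k)$ of non-negative integers such that for every two graphs $G$ and $G'$ on the same set $V$ of $v$ vertices which are $k$-hypomorphic up to complementation, one has $G'=G$ or $G'=\overline{G}$. Then: \begin{enumerate} \item If $v\leq 2$, then $(v,k)\in\mathcal S$ for every $k\in\mathbb N$. \item Let $v>2$. If $(v,k)\in\mathcal S$ then $4\leq k\leq v-2$. Moreover: \begin{enumerate} \item If $v\equiv 2 \pmod 4$, then $(v,k)\in\mathcal S$ if and only if $4\leq k\leq v-2$. \item If $v\equiv 0\pmod 4$ or $v\equiv 3\pmod 4$, then $4\leq k\leq v-3$ implies $(v,k)\in\mathcal S$; and there are infinitely many such $v$ for which $(v,k)\in\mathcal S$ implies $k\leq v-3$. \item If $v\equiv 1\pmod 4$, then $4\leq k\leq v-4$ implies $(v,k)\in\mathcal S$; and there are infinitely many such $v$ for which $(v,k)\in\mathcal S$ implies $k\leq v-4$. \end{enumerate} \end{enumerate}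
   Context: A graph is a pair $G=(V,E)$ with $E$ a set of 2-element subsets of $V$. The complement of $G$ is $\overline G=(V,[V]^2\setminus E)$, where $[V]^2$ is the set of 2-element subsets of $V$. For $K\subseteq V$, $G_{\restriction K}=(K,[K]^2\cap E)$ is the induced subgraph. Two graphs are isomorphic up to complementation if one is isomorphic to the other or to its complement. Two graphs $G,G'$ on the same vertex set $V$ are $k$-hypomorphic up to complementation if for every $k$-element subset $K$ of $V$, $G_{\restriction K}$ and $G'_{\restriction K}$ are isomorphic up to complementation. *)

theory Defs
  imports Main "HOL-Library.Ramsey"
begin

(* A graph is a pair (V, E); [V]\<^bsup>2\<^esup> is the library's nsets V 2, the set of 2-element
   subsets of V. *)
type_synonym 'a sgraph = "'a set \<times> 'a set set"

definition is_graph :: "'a sgraph \<Rightarrow> bool" where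
  "is_graph G \<longleftrightarrow> snd G \<subseteq> [fst G]\<^bsup>2\<^esup>"

definition graph_compl :: "'a sgraph \<Rightarrow> 'a sgraph" where
  "graph_compl G = (fst G, [fst G]\<^bsup>2\<^esup> - snd G)"

definition induced_graph :: "'a sgraph \<Rightarrow> 'a set \<Rightarrow> 'a sgraph" where
  "induced_graph G K = (K, [K]\<^bsup>2\<^esup> \<inter> snd G)"

definition graph_iso :: "'a sgraph \<Rightarrow> 'b sgraph \<Rightarrow> bool" where
  "graph_iso G H \<longleftrightarrow>
    (\<exists>f. bij_betw f (fst G) (fst H) \<and>
      (\<forall>x\<in>fst G. \<forall>y\<in>fst G. {x, y} \<in> snd G \<longleftrightarrow> {f x, f y} \<in> snd H))"

definition iso_upto_compl :: "'a sgraph \<Rightarrow> 'b sgraph \<Rightarrow> bool" where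
  "iso_upto_compl G H \<longleftrightarrow> graph_iso G H \<or> graph_iso G (graph_compl H)"

(* Meant for graphs G, G' with the same vertex set. *)
definition hypomorphic_upto_compl :: "nat \<Rightarrow> 'a sgraph \<Rightarrow> 'a sgraph \<Rightarrow> bool" where
  "hypomorphic_upto_compl k G G' \<longleftrightarrow>
    (\<forall>K\<in>[fst G]\<^bsup>k\<^esup>. iso_upto_compl (induced_graph G K) (induced_graph G' K))"

definition hypomorphic_imp_eq_upto_compl :: "'a set \<Rightarrow> nat \<Rightarrow> bool" where
  "hypomorphic_imp_eq_upto_compl V k \<longleftrightarrow>
    (\<forall>G G'. is_graph G \<and> is_graph G' \<and> fst G = V \<and> fst G' = V
      \<and> hypomorphic_upto_compl k G G' \<longrightarrow> G' = G \<or> G' = graph_compl G)"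

(* The set S of pairs (v, k). A definition cannot quantify over types, so the vertices are taken
   to be natural numbers; by rigid_pairs_iff below this yields the condition for finite vertex
   sets of every type. *)
definition rigid_pairs :: "(nat \<times> nat) set" where
  "rigid_pairs = {(v, k). \<forall>V :: nat set. finite V \<and> card V = v
     \<longrightarrow> hypomorphic_imp_eq_upto_compl V k}"

definition map_graph :: "('a \<Rightarrow> 'b) \<Rightarrow> 'a sgraph \<Rightarrow> 'b sgraph" where
  "map_graph f G = (f ` fst G, (\<lambda>e. f ` e) ` snd G)"

lemma map_graph_edge:
  assumes "inj_on f (fst G)" "is_graph G" "x \<in> fst G" "y \<in> fst G"
  shows "{f x, f y} \<in> snd (map_graph f G) \<longleftrightarrow> {x, y} \<in> snd G"
proof
  assume "{f x, f y} \<in> snd (map_graph f G)"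
  then have "f ` {x, y} \<in> (\<lambda>e. f ` e) ` snd G"
    by (simp add: map_graph_def)
  then obtain e where e: "f ` {x, y} = f ` e" "e \<in> snd G"
    by (rule imageE)
  then have "e \<subseteq> fst G"
    using assms(2) by (auto simp: is_graph_def nsets_def)
  then have "e = {x, y}"
    using inj_on_image_eq_iff[OF assms(1), of e "{x, y}"] e(1)[symmetric] assms(3,4) by blast
  then show "{x, y} \<in> snd G" using e(2) by simp
next
  assume "{x, y} \<in> snd G"
  then have "f ` {x, y} \<in> (\<lambda>e. f ` e) ` snd G" by (rule imageI)
  then show "{f x, f y} \<in> snd (map_graph f G)"
    by (simp add: map_graph_def)
qed

lemma is_graph_map_graph:
  assumes "inj_on f (fst G)" "is_graph G"
  shows "is_graph (map_graph f G)"
  unfolding is_graph_def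
proof
  fix e assume "e \<in> snd (map_graph f G)"
  then obtain d where d: "d \<in> snd G" "e = f ` d" by (auto simp: map_graph_def)
  then have "d \<in> [fst G]\<^bsup>2\<^esup>" using assms by (auto simp: is_graph_def)
  then obtain x y where "d = {x, y}" "x \<in> fst G" "y \<in> fst G" "x \<noteq> y"
    by (auto elim: nsets2_E)
  then show "e \<in> [fst (map_graph f G)]\<^bsup>2\<^esup>"
    using d assms by (auto simp: map_graph_def inj_on_def)
qed

lemma graph_eqI:
  assumes "is_graph G" "is_graph H" "fst G = fst H"
    and "\<And>x y. x \<in> fst G \<Longrightarrow> y \<in> fst G \<Longrightarrow> x \<noteq> y \<Longrightarrow> {x, y} \<in> snd G \<longleftrightarrow> {x, y} \<in> snd H"
  shows "G = H"
proof (rule prod_eqI)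
  show "snd G = snd H"
  proof (rule set_eqI)
    fix e show "e \<in> snd G \<longleftrightarrow> e \<in> snd H"
    proof (cases "e \<in> [fst G]\<^bsup>2\<^esup>")
      case True
      then show ?thesis using assms(4) by (auto elim!: nsets2_E)
    next
      case False
      then show ?thesis using assms by (auto simp: is_graph_def)
    qed
  qed
qed (fact assms(3))

lemma is_graph_compl [simp]: "is_graph (graph_compl G)"
  by (auto simp: is_graph_def graph_compl_def)

lemma fst_graph_compl: "fst (graph_compl G) = fst G"
  by (simp add: graph_compl_def)

lemma hypomorphic_map_graph:
  assumes inj: "inj_on f V" and G: "is_graph G" "fst G = V" and G': "is_graph G'" "fst G' = V"
    and hyp: "hypomorphic_upto_compl k G G'"
  shows "hypomorphic_upto_compl k (map_graph f G) (map_graph f G')"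
  unfolding hypomorphic_upto_compl_def
proof
  fix L assume "L \<in> [fst (map_graph f G)]\<^bsup>k\<^esup>"
  then have L: "L \<subseteq> f ` V" "finite L" "card L = k"
    using G by (auto simp: nsets_def map_graph_def)
  then obtain K where K: "K \<subseteq> V" "L = f ` K" by (auto simp: subset_image_iff)
  have injK: "inj_on f K" using inj K inj_on_subset by blast
  have "K \<in> [fst G]\<^bsup>k\<^esup>"
    using L K G injK by (auto simp: nsets_def card_image finite_image_iff)
  then have iso: "iso_upto_compl (induced_graph G K) (induced_graph G' K)"
    using hyp by (auto simp: hypomorphic_upto_compl_def)
  define g where "g = the_inv_into K f"
  have g: "g (f x) = x" if "x \<in> K" for x
    using that injK by (simp add: g_def the_inv_into_f_f)
  have bijf: "bij_betw f K L" using injK K by (simp add: bij_betw_def)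
  have bijg: "bij_betw g L K"
    unfolding g_def using bijf by (rule bij_betw_the_inv_into)
  have edge: "{f x, f y} \<in> snd (map_graph f H) \<longleftrightarrow> {x, y} \<in> snd H"
    if "is_graph H" "fst H = V" "x \<in> K" "y \<in> K" for H x y
    using map_graph_edge[of f H x y] that inj K by auto
  have eq_iff: "f x = f y \<longleftrightarrow> x = y" if "x \<in> K" "y \<in> K" for x y
    using that injK by (auto simp: inj_on_def)
  have bij: "bij_betw (f \<circ> h \<circ> g) L L" if "bij_betw h K K" for h
    using bij_betw_trans[OF bijg bij_betw_trans[OF that bijf]] by (simp add: comp_assoc)
  have inK: "h x \<in> K" if "bij_betw h K K" "x \<in> K" for h x
    using that by (auto simp: bij_betw_def)
  have "(\<exists>h. bij_betw h K K \<and>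
      (\<forall>x\<in>K. \<forall>y\<in>K. {x, y} \<in> [K]\<^bsup>2\<^esup> \<inter> snd G \<longleftrightarrow> {h x, h y} \<in> [K]\<^bsup>2\<^esup> \<inter> snd G')) \<or>
    (\<exists>h. bij_betw h K K \<and>
      (\<forall>x\<in>K. \<forall>y\<in>K. {x, y} \<in> [K]\<^bsup>2\<^esup> \<inter> snd G \<longleftrightarrow> {h x, h y} \<in> [K]\<^bsup>2\<^esup> - [K]\<^bsup>2\<^esup> \<inter> snd G'))"
    using iso
    unfolding iso_upto_compl_def graph_iso_def induced_graph_def graph_compl_def fst_conv snd_conv .
  then show "iso_upto_compl (induced_graph (map_graph f G) L) (induced_graph (map_graph f G') L)"
  proof (elim disjE exE conjE)
    fix h
    assume 1: "bij_betw h K K"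
      "\<forall>x\<in>K. \<forall>y\<in>K. {x, y} \<in> [K]\<^bsup>2\<^esup> \<inter> snd G \<longleftrightarrow> {h x, h y} \<in> [K]\<^bsup>2\<^esup> \<inter> snd G'"
    have "graph_iso (induced_graph (map_graph f G) L) (induced_graph (map_graph f G') L)"
      unfolding graph_iso_def induced_graph_def fst_conv snd_conv
    proof (intro exI[of _ "f \<circ> h \<circ> g"] conjI ballI bij 1(1))
      fix a b assume "a \<in> L" "b \<in> L"
      then obtain x y where xy: "a = f x" "b = f y" "x \<in> K" "y \<in> K" using K by auto
      show "{a, b} \<in> [L]\<^bsup>2\<^esup> \<inter> snd (map_graph f G) \<longleftrightarrow>
          {(f \<circ> h \<circ> g) a, (f \<circ> h \<circ> g) b} \<in> [L]\<^bsup>2\<^esup> \<inter> snd (map_graph f G')"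
        unfolding xy comp_apply g[OF xy(3)] g[OF xy(4)]
        using 1(2)[rule_format, OF xy(3,4)] xy(3,4) inK[OF 1(1) xy(3)] inK[OF 1(1) xy(4)]
          edge[OF G xy(3,4)] edge[OF G' inK[OF 1(1) xy(3)] inK[OF 1(1) xy(4)]]
          eq_iff[OF xy(3,4)] eq_iff[OF inK[OF 1(1) xy(3)] inK[OF 1(1) xy(4)]] K(2)
        by simp
    qed
    then show ?thesis by (simp add: iso_upto_compl_def)
  next
    fix h
    assume 2: "bij_betw h K K"
      "\<forall>x\<in>K. \<forall>y\<in>K. {x, y} \<in> [K]\<^bsup>2\<^esup> \<inter> snd G \<longleftrightarrow> {h x, h y} \<in> [K]\<^bsup>2\<^esup> - [K]\<^bsup>2\<^esup> \<inter> snd G'"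
    have "graph_iso (induced_graph (map_graph f G) L)
        (graph_compl (induced_graph (map_graph f G') L))"
      unfolding graph_iso_def induced_graph_def graph_compl_def fst_conv snd_conv
    proof (intro exI[of _ "f \<circ> h \<circ> g"] conjI ballI bij 2(1))
      fix a b assume "a \<in> L" "b \<in> L"
      then obtain x y where xy: "a = f x" "b = f y" "x \<in> K" "y \<in> K" using K by auto
      show "{a, b} \<in> [L]\<^bsup>2\<^esup> \<inter> snd (map_graph f G) \<longleftrightarrow>
          {(f \<circ> h \<circ> g) a, (f \<circ> h \<circ> g) b} \<in> [L]\<^bsup>2\<^esup> - [L]\<^bsup>2\<^esup> \<inter> snd (map_graph f G')"
        unfolding xy comp_apply g[OF xy(3)] g[OF xy(4)]
        using 2(2)[rule_format, OF xy(3,4)] xy(3,4) inK[OF 2(1) xy(3)] inK[OF 2(1) xy(4)]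
          edge[OF G xy(3,4)] edge[OF G' inK[OF 2(1) xy(3)] inK[OF 2(1) xy(4)]]
          eq_iff[OF xy(3,4)] eq_iff[OF inK[OF 2(1) xy(3)] inK[OF 2(1) xy(4)]] K(2)
        by simp
    qed
    then show ?thesis by (simp add: iso_upto_compl_def)
  qed
qed

lemma hypomorphic_imp_eq_transfer:
  fixes f :: "'a \<Rightarrow> 'b"
  assumes bij: "bij_betw f V W" and W: "hypomorphic_imp_eq_upto_compl W k"
  shows "hypomorphic_imp_eq_upto_compl V k"
  unfolding hypomorphic_imp_eq_upto_compl_def
proof (intro allI impI, elim conjE)
  fix G G' :: "'a sgraph"
  assume G: "is_graph G" "fst G = V" and G': "is_graph G'" "fst G' = V"
    and hyp: "hypomorphic_upto_compl k G G'"
  have inj: "inj_on f V" and im: "f ` V = W" using bij by (auto simp: bij_betw_def)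
  have "map_graph f G' = map_graph f G \<or> map_graph f G' = graph_compl (map_graph f G)"
    using W is_graph_map_graph[of f G] is_graph_map_graph[of f G'] G G' inj im
      hypomorphic_map_graph[OF inj G G' hyp]
    unfolding hypomorphic_imp_eq_upto_compl_def by (simp add: map_graph_def)
  then show "G' = G \<or> G' = graph_compl G"
  proof
    assume *: "map_graph f G' = map_graph f G"
    have "G' = G"
    proof (rule graph_eqI)
      fix x y assume "x \<in> fst G'" "y \<in> fst G'"
      then show "{x, y} \<in> snd G' \<longleftrightarrow> {x, y} \<in> snd G"
        using map_graph_edge[of f G x y] map_graph_edge[of f G' x y] * G G' inj by simp
    qed (use G G' in auto)
    then show ?thesis ..
  next
    assume *: "map_graph f G' = graph_compl (map_graph f G)"
    have "G' = graph_compl G"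
    proof (rule graph_eqI)
      fix x y assume xy: "x \<in> fst G'" "y \<in> fst G'" "x \<noteq> y"
      have "{x, y} \<in> snd G' \<longleftrightarrow> {f x, f y} \<in> snd (graph_compl (map_graph f G))"
        using map_graph_edge[of f G' x y] * G' xy inj by simp
      also have "\<dots> \<longleftrightarrow> {f x, f y} \<notin> snd (map_graph f G)"
        using xy G G' inj by (auto simp: graph_compl_def map_graph_def inj_on_def)
      also have "\<dots> \<longleftrightarrow> {x, y} \<in> snd (graph_compl G)"
        using map_graph_edge[of f G x y] G G' xy inj by (simp add: graph_compl_def)
      finally show "{x, y} \<in> snd G' \<longleftrightarrow> {x, y} \<in> snd (graph_compl G)" .
    qed (simp_all add: G G' fst_graph_compl)
    then show ?thesis ..
  qed
qed

lemma rigid_pairs_iff: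
  fixes V :: "'a set"
  assumes "finite V" "card V = v"
  shows "(v, k) \<in> rigid_pairs \<longleftrightarrow> hypomorphic_imp_eq_upto_compl V k"
proof
  assume "(v, k) \<in> rigid_pairs"
  then have "hypomorphic_imp_eq_upto_compl {0..<v} k" by (auto simp: rigid_pairs_def)
  moreover obtain f where "bij_betw f V {0..<v}"
    using ex_bij_betw_finite_nat[OF assms(1)] assms(2) by blast
  ultimately show "hypomorphic_imp_eq_upto_compl V k" by (rule hypomorphic_imp_eq_transfer[rotated])
next
  assume V: "hypomorphic_imp_eq_upto_compl V k"
  have "hypomorphic_imp_eq_upto_compl W k" if W: "finite W" "card W = v" for W :: "nat set"
  proof -
    obtain f where "bij_betw f W V"
      using finite_same_card_bij[OF W(1) assms(1)] W(2) assms(2) by auto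
    then show ?thesis using V by (rule hypomorphic_imp_eq_transfer)
  qed
  then show "(v, k) \<in> rigid_pairs" by (auto simp: rigid_pairs_def)
qed

end

(*
  Let U be the Boolean sum of the edge sets of G and G', and let \<sigma> be 1 on the edges of G and
  -1 on its non-edges. Comparing numbers of edges, k-hypomorphy up to complementation says that on
  every k-subset K the product D(K) Q(K) vanishes, where D and Q are the sums of \<sigma> over the pairs
  of K inside and outside U.

  If 4 divides k, this makes the number of U-edges of K even for all K, which for k \<le> v - 2 forces U
  to be empty or complete.

  If k \<le> v - 3, inclusion-exclusion (Gottlieb-Kantor) shows that G and G' have the same homogeneous
  triples; hence intersecting pairs do not contribute to D(K) Q(K), which becomes a sum over
  the 4-subsets F of K of an integer with the parity of the number of U-edges of F. For k \<le> v - 4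
  inclusion-exclusion makes each summand vanish, which reduces to the case k = 4. For k = v - 3 it
  makes the sum over all F containing a given triple T vanish; with k odd this says that the number
  of U-edges of T has the parity of the sum of the U-degrees of its points. So all these numbers
  have the same parity, U or its complement is a complete bipartite graph, and the homogeneous
  triples exclude this unless U or its complement is empty.

  The counterexamples join a graph W to the points 0 and 2 of a 4-cycle 0123, and to no points 1
  and 3; G and G' contain alternate edges of the cycle. Exchanging two opposite points of the cycle
  maps G to G', and so does exchanging two adjacent points up to complementation, once the
  other two are deleted and what is left of W is self-complementary.
*)

theory Submission
  imports Defs
begin

section \<open>Isomorphism up to complementation in terms of edge sets\<close>

lemma ball_nsets2: "(\<forall>e\<in>[K]\<^bsup>2\<^esup>. P e) \<longleftrightarrow> (\<forall>x\<in>K. \<forall>y\<in>K. x \<noteq> y \<longrightarrow> P {x, y})"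
  by (auto elim!: nsets2_E)

lemma graph_iso_induced_iff:
  assumes f: "bij_betw f K K"
  shows "(\<forall>x\<in>K. \<forall>y\<in>K. {x, y} \<in> [K]\<^bsup>2\<^esup> \<inter> A \<longleftrightarrow> {f x, f y} \<in> [K]\<^bsup>2\<^esup> \<inter> B)
    \<longleftrightarrow> (\<forall>e\<in>[K]\<^bsup>2\<^esup>. e \<in> A \<longleftrightarrow> f ` e \<in> B)"
proof -
  have "f x \<in> K" if "x \<in> K" for x
    using f that by (auto simp: bij_betw_def)
  moreover have "f x = f y \<longleftrightarrow> x = y" if "x \<in> K" "y \<in> K" for x y
    using f that by (auto simp: bij_betw_def inj_on_def)
  ultimately show ?thesis
    unfolding ball_nsets2 by auto
qed

text \<open>The Boolean \<open>c\<close> merges the two alternatives: \<open>True\<close> for an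
  isomorphism, \<open>False\<close> for an isomorphism onto the complement.\<close>

lemma iso_upto_compl_induced_iff:
  "iso_upto_compl (induced_graph G K) (induced_graph G' K) \<longleftrightarrow>
    (\<exists>f c. bij_betw f K K \<and> (\<forall>e\<in>[K]\<^bsup>2\<^esup>. e \<in> snd G \<longleftrightarrow> (f ` e \<in> snd G' \<longleftrightarrow> c)))"
proof -
  have "[K]\<^bsup>2\<^esup> - [K]\<^bsup>2\<^esup> \<inter> snd G' = [K]\<^bsup>2\<^esup> \<inter> - snd G'" by auto
  then have "iso_upto_compl (induced_graph G K) (induced_graph G' K) \<longleftrightarrow>
      (\<exists>f. bij_betw f K K \<and> (\<forall>e\<in>[K]\<^bsup>2\<^esup>. e \<in> snd G \<longleftrightarrow> f ` e \<in> snd G')) \<or>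
      (\<exists>f. bij_betw f K K \<and> (\<forall>e\<in>[K]\<^bsup>2\<^esup>. e \<in> snd G \<longleftrightarrow> f ` e \<in> - snd G'))"
    unfolding iso_upto_compl_def graph_iso_def induced_graph_def graph_compl_def fst_conv snd_conv
    by (simp only: graph_iso_induced_iff cong: conj_cong)
  also have "\<dots> \<longleftrightarrow>
      (\<exists>f c. bij_betw f K K \<and> (\<forall>e\<in>[K]\<^bsup>2\<^esup>. e \<in> snd G \<longleftrightarrow> (f ` e \<in> snd G' \<longleftrightarrow> c)))"
    by (simp add: ex_bool_eq ex_disj_distrib[symmetric] conj_disj_distribL[symmetric])
  finally show ?thesis .
qed

lemma sum_nsets2_insert:
  assumes "finite K" "x \<notin> K"
  shows "(\<Sum>e\<in>[insert x K]\<^bsup>2\<^esup>. g e) = (\<Sum>e\<in>[K]\<^bsup>2\<^esup>. g e) + (\<Sum>z\<in>K. g {x, z})"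
proof -
  have "[insert x K]\<^bsup>2\<^esup> = [K]\<^bsup>2\<^esup> \<union> (\<lambda>z. {x, z}) ` K"
    using assms by (auto elim!: nsets2_E simp: insert_commute)
  moreover have "[K]\<^bsup>2\<^esup> \<inter> (\<lambda>z. {x, z}) ` K = {}"
    using assms by (auto simp: nsets_def)
  moreover have "inj_on (\<lambda>z. {x, z}) K"
    by (auto simp: inj_on_def doubleton_eq_iff)
  ultimately show ?thesis
    using assms by (simp add: sum.union_disjoint finite_imp_finite_nsets sum.reindex)
qed

subsection \<open>Inclusion-exclusion\<close>

text \<open>Two inductions: averaging extends \<open>zero\<close> from avoided sets of size
  \<open>s\<close> to all smaller ones, and inclusion-exclusion then turns avoided points into
  contained ones.\<close>

lemma sum_supersets_eq_0:
  fixes \<phi> :: "'a set \<Rightarrow> int"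
  assumes V: "finite V" "s + t \<le> card V"
    and zero: "\<And>T. T \<in> [V]\<^bsup>s\<^esup> \<Longrightarrow> (\<Sum>F\<in>[V - T]\<^bsup>t\<^esup>. \<phi> F) = 0"
    and S: "S \<in> [V]\<^bsup>s\<^esup>"
  shows "(\<Sum>F | F \<in> [V]\<^bsup>t\<^esup> \<and> S \<subseteq> F. \<phi> F) = 0"
proof -
  define N where "N A B = (\<Sum>F\<in>[V]\<^bsup>t\<^esup>. if A \<subseteq> F \<and> F \<inter> B = {} then \<phi> F else 0)" for A B
  have fin: "finite ([V]\<^bsup>t\<^esup>)"
    using V by (simp add: finite_imp_finite_nsets)
  have avoid: "N {} B = 0" if "B \<subseteq> V" "card B \<le> s" for B
    using that(2,1)
  proof (induction "s - card B" arbitrary: B)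
    case 0
    have "[V - B]\<^bsup>t\<^esup> = {F \<in> [V]\<^bsup>t\<^esup>. F \<inter> B = {}}" by (auto simp: nsets_def)
    then have "N {} B = (\<Sum>F\<in>[V - B]\<^bsup>t\<^esup>. \<phi> F)"
      using fin by (simp add: N_def sum.inter_filter)
    also have "\<dots> = 0"
      using 0 V finite_subset[OF 0(3) V(1)] by (intro zero) (auto simp: nsets_def)
    finally show ?case .
  next
    case (Suc n)
    have B: "finite B" using Suc.prems V finite_subset by blast
    have "N {} (insert x B) = 0" if "x \<in> V - B" for x
      using Suc that B by (intro Suc.hyps(1)) auto
    then have "0 = (\<Sum>x\<in>V - B. N {} (insert x B))" by simp
    also have "\<dots> = (\<Sum>F\<in>[V]\<^bsup>t\<^esup>. \<Sum>x\<in>V - B. if F \<inter> insert x B = {} then \<phi> F else 0)"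
      unfolding N_def by (subst sum.swap) simp
    \<comment> \<open>A \<open>t\<close>-set F that misses B is missed by exactly
      \<open>card V - card B - t\<close> further points. While B has fewer than \<open>s\<close>
      points this factor is positive, as \<open>s + t \<le> card V\<close>, so it can be
      cancelled.\<close>
    also have "\<dots> = (\<Sum>F\<in>[V]\<^bsup>t\<^esup>. int (card V - card B - t) * (if F \<inter> B = {} then \<phi> F else 0))"
    proof (rule sum.cong[OF refl])
      fix F assume F: "F \<in> [V]\<^bsup>t\<^esup>"
      show "(\<Sum>x\<in>V - B. if F \<inter> insert x B = {} then \<phi> F else 0)
          = int (card V - card B - t) * (if F \<inter> B = {} then \<phi> F else 0)"
      proof (cases "F \<inter> B = {}")
        case True
        have "(\<Sum>x\<in>V - B. if F \<inter> insert x B = {} then \<phi> F else 0) = (\<Sum>x | x \<in> V - B \<and> x \<notin> F. \<phi> F)"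
          using True V by (intro sum.mono_neutral_cong_right) auto
        also have "\<dots> = int (card (V - B - F)) * \<phi> F"
          by (simp add: set_diff_eq)
        also have "card (V - B - F) = card V - card B - t"
          using F True Suc.prems B by (subst card_Diff_subset, auto simp: nsets_def card_Diff_subset)
        finally show ?thesis using True by simp
      next
        case False
        then have "F \<inter> insert x B \<noteq> {}" for x by auto
        then show ?thesis using False by simp
      qed
    qed
    also have "\<dots> = int (card V - card B - t) * N {} B"
      by (simp add: N_def sum_distrib_left)
    finally show ?case using V Suc by auto
  qed
  \<comment> \<open>To require a point \<open>a\<close>, subtract the sets that avoid it; required
    and avoided points together never exceed \<open>s\<close>.\<close>
  have "N A B = 0" if "finite A" "A \<union> B \<subseteq> V" "A \<inter> B = {}" "card A + card B \<le> s" for A B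
    using that
  proof (induction A arbitrary: B rule: finite_induct)
    case empty
    then show ?case by (intro avoid) auto
  next
    case (insert a A)
    have B: "finite B" using insert.prems V finite_subset by blast
    have "N A B = N (insert a A) B + N A (insert a B)"
      unfolding N_def sum.distrib[symmetric] by (rule sum.cong) auto
    moreover have "N A B = 0" using insert by (intro insert.IH) auto
    moreover have "N A (insert a B) = 0" using insert B by (intro insert.IH) auto
    ultimately show ?case by simp
  qed
  then have "N S {} = 0" using S by (simp add: nsets_def)
  then show ?thesis using fin by (simp add: N_def sum.inter_filter)
qed

text \<open>This is the Gottlieb-Kantor theorem on inclusion matrices. It suffices to work inside a set
  of size \<open>t + k\<close>.\<close>

lemma sum_nsets_eq_0_imp:
  fixes \<phi> :: "'a set \<Rightarrow> int"
  assumes V: "finite V" and k: "t \<le> k" "t + k \<le> card V"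
    and zero: "\<And>K. K \<in> [V]\<^bsup>k\<^esup> \<Longrightarrow> (\<Sum>F\<in>[K]\<^bsup>t\<^esup>. \<phi> F) = 0"
    and S: "S \<in> [V]\<^bsup>t\<^esup>"
  shows "\<phi> S = 0"
proof -
  have S': "S \<subseteq> V" "finite S" "card S = t" using S by (auto simp: nsets_def)
  have "k \<le> card (V - S)" using S' k by (simp add: card_Diff_subset)
  then obtain L where L: "L \<subseteq> V - S" "card L = k" "finite L"
    by (rule obtain_subset_with_card_n)
  define X where "X = S \<union> L"
  have "S \<inter> L = {}" using L by auto
  then have X: "finite X" "card X = t + k" "X \<subseteq> V" "S \<in> [X]\<^bsup>t\<^esup>"
    using L S' by (auto simp: X_def card_Un_disjoint nsets_def)
  \<comment> \<open>Inside \<open>X\<close> the complement of a \<open>t\<close>-set is a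
    \<open>k\<close>-set, so \<open>zero\<close> is a statement about avoiding
    \<open>t\<close>-sets. The only \<open>t\<close>-set containing \<open>S\<close> is
    \<open>S\<close> itself.\<close>
  have "(\<Sum>F | F \<in> [X]\<^bsup>t\<^esup> \<and> S \<subseteq> F. \<phi> F) = 0"
  proof (rule sum_supersets_eq_0)
    fix T assume "T \<in> [X]\<^bsup>t\<^esup>"
    then have "X - T \<in> [V]\<^bsup>k\<^esup>" using X by (auto simp: nsets_def card_Diff_subset)
    then show "(\<Sum>F\<in>[X - T]\<^bsup>t\<^esup>. \<phi> F) = 0" by (rule zero)
  qed (use X k in auto)
  moreover have "{F. F \<in> [X]\<^bsup>t\<^esup> \<and> S \<subseteq> F} = {S}"
    using X(4) S' card_subset_eq[of _ S] by (fastforce simp: nsets_def)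
  ultimately show ?thesis by simp
qed

subsection \<open>Products of signed edge counts\<close>

definition edge_sign :: "'a set set \<Rightarrow> 'a set \<Rightarrow> int" where
  "edge_sign E e = (if e \<in> E then 1 else - 1)"

definition homogeneous :: "'a set set \<Rightarrow> 'a set \<Rightarrow> bool" where
  "homogeneous E T \<longleftrightarrow> [T]\<^bsup>2\<^esup> \<subseteq> E \<or> [T]\<^bsup>2\<^esup> \<inter> E = {}"

text \<open>The term of \<open>e\<close> and \<open>f\<close> in the expansion of D(K) Q(K); the
  default 0 lets both range over all pairs.\<close>

definition mixed :: "('a set \<Rightarrow> int) \<Rightarrow> 'a set set \<Rightarrow> 'a set \<Rightarrow> 'a set \<Rightarrow> int" where
  "mixed \<sigma> U e f = (if e \<in> U \<and> f \<notin> U then \<sigma> e * \<sigma> f else 0)"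

text \<open>Only complementary pairs contribute if \<open>X\<close> has four points, only intersecting ones if it has
  three.\<close>

definition cross :: "('a set \<Rightarrow> int) \<Rightarrow> 'a set set \<Rightarrow> 'a set \<Rightarrow> int" where
  "cross \<sigma> U X =
    (\<Sum>e\<in>[X]\<^bsup>2\<^esup>. \<Sum>f\<in>[X]\<^bsup>2\<^esup>. if e \<union> f = X then mixed \<sigma> U e f else 0)"

text \<open>Expand the product and sort the terms by the union of their two pairs.\<close>

lemma prod_eq_sum_cross:
  assumes "finite K"
  shows "(\<Sum>e\<in>[K]\<^bsup>2\<^esup> \<inter> U. \<sigma> e) * (\<Sum>e\<in>[K]\<^bsup>2\<^esup> - U. \<sigma> e) = (\<Sum>X\<in>Pow K. cross \<sigma> U X)"
proof -
  have fin: "finite ([X]\<^bsup>2\<^esup>)" if "X \<subseteq> K" for X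
    using that assms finite_subset finite_imp_finite_nsets by blast
  \<comment> \<open>Two pairs that do not both lie in \<open>X\<close> cannot have union
    \<open>X\<close>, so both ranges may be enlarged to the pairs of \<open>K\<close>.\<close>
  have cross: "cross \<sigma> U X = (\<Sum>e\<in>[K]\<^bsup>2\<^esup>. \<Sum>f\<in>[K]\<^bsup>2\<^esup>. if e \<union> f = X then mixed \<sigma> U e f else 0)"
    if "X \<subseteq> K" for X
  proof -
    have sub: "[X]\<^bsup>2\<^esup> \<subseteq> [K]\<^bsup>2\<^esup>" using that by (rule nsets_mono)
    have outside: "e \<union> f \<noteq> X"
      if "e \<in> [K]\<^bsup>2\<^esup> \<union> [X]\<^bsup>2\<^esup>" "f \<in> [K]\<^bsup>2\<^esup> \<union> [X]\<^bsup>2\<^esup>" "e \<notin> [X]\<^bsup>2\<^esup> \<or> f \<notin> [X]\<^bsup>2\<^esup>" for e f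
      using that by (auto simp: nsets_def)
    have "cross \<sigma> U X = (\<Sum>e\<in>[X]\<^bsup>2\<^esup>. \<Sum>f\<in>[K]\<^bsup>2\<^esup>. if e \<union> f = X then mixed \<sigma> U e f else 0)"
      unfolding cross_def using sub fin[OF order.refl]
      by (intro sum.cong[OF refl] sum.mono_neutral_cong_left) (simp_all add: outside)
    also have "\<dots> = (\<Sum>e\<in>[K]\<^bsup>2\<^esup>. \<Sum>f\<in>[K]\<^bsup>2\<^esup>. if e \<union> f = X then mixed \<sigma> U e f else 0)"
      using sub fin[OF order.refl]
      by (intro sum.mono_neutral_left) (simp_all add: outside)
    finally show ?thesis .
  qed
  have "(\<Sum>e\<in>[K]\<^bsup>2\<^esup> \<inter> U. \<sigma> e) * (\<Sum>e\<in>[K]\<^bsup>2\<^esup> - U. \<sigma> e) =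
      (\<Sum>e\<in>[K]\<^bsup>2\<^esup> \<inter> U. \<Sum>f\<in>[K]\<^bsup>2\<^esup> - U. \<sigma> e * \<sigma> f)"
    by (rule sum_product)
  also have "\<dots> = (\<Sum>e\<in>[K]\<^bsup>2\<^esup> \<inter> U. \<Sum>f\<in>[K]\<^bsup>2\<^esup>. mixed \<sigma> U e f)"
    using fin[OF order.refl]
    by (intro sum.cong sum.mono_neutral_cong_left refl) (auto simp: mixed_def)
  also have "\<dots> = (\<Sum>e\<in>[K]\<^bsup>2\<^esup>. \<Sum>f\<in>[K]\<^bsup>2\<^esup>. mixed \<sigma> U e f)"
    using fin[OF order.refl] by (intro sum.mono_neutral_left) (auto simp: mixed_def)
  also have "\<dots> = (\<Sum>e\<in>[K]\<^bsup>2\<^esup>. \<Sum>f\<in>[K]\<^bsup>2\<^esup>. \<Sum>X\<in>Pow K. if e \<union> f = X then mixed \<sigma> U e f else 0)"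
    using assms by (intro sum.cong refl) (auto simp: nsets_def)
  also have "\<dots> = (\<Sum>X\<in>Pow K. \<Sum>e\<in>[K]\<^bsup>2\<^esup>. \<Sum>f\<in>[K]\<^bsup>2\<^esup>. if e \<union> f = X then mixed \<sigma> U e f else 0)"
    by (subst sum.swap[of _ "Pow K"], subst sum.swap[of _ "Pow K"]) (rule refl)
  also have "\<dots> = (\<Sum>X\<in>Pow K. cross \<sigma> U X)"
    using cross by (intro sum.cong) auto
  finally show ?thesis .
qed

text \<open>In a nonzero term one pair lies in \<open>U\<close> and the other does not, so they are
  distinct and their union has three or four points.\<close>

lemma cross_eq_0:
  assumes "card X \<noteq> 3" "card X \<noteq> 4"
  shows "cross \<sigma> U X = 0"
proof -
  have False if ef: "e \<in> [X]\<^bsup>2\<^esup>" "f \<in> [X]\<^bsup>2\<^esup>" "e \<in> U" "f \<notin> U" "e \<union> f = X" for e f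
  proof -
    have "card X \<noteq> 2"
    proof
      assume "card X = 2"
      then have "e = X" "f = X"
        using ef card_subset_eq[of X e] card_subset_eq[of X f] by (auto simp: nsets_def)
      then show False using ef by simp
    qed
    moreover have "card e \<le> card X" "card X \<le> card e + card f" "card e = 2" "card f = 2"
      using ef card_mono[of X e] card_Un_le[of e f] by (auto simp: nsets_def)
    ultimately show False using assms by linarith
  qed
  then show ?thesis unfolding cross_def mixed_def by (intro sum.neutral ballI) auto
qed

lemma nsets2_empty: "[{}]\<^bsup>2\<^esup> = {}"
  by (auto elim!: nsets2_E)

lemma mixed_self: "mixed \<sigma> U e e = 0"
  by (simp add: mixed_def)

lemma cross_quadruple:
  assumes "a \<noteq> b" "a \<noteq> c" "a \<noteq> d" "b \<noteq> c" "b \<noteq> d" "c \<noteq> d"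
  shows "cross \<sigma> U {a, b, c, d} =
    mixed \<sigma> U {a, b} {c, d} + mixed \<sigma> U {c, d} {a, b} +
    mixed \<sigma> U {a, c} {b, d} + mixed \<sigma> U {b, d} {a, c} +
    mixed \<sigma> U {a, d} {b, c} + mixed \<sigma> U {b, c} {a, d}"
proof -
  \<comment> \<open>Written with memberships, the condition on the union can be decided by
    \<open>simp\<close> for each combination of two pairs.\<close>
  have "{w, x} \<union> {y, z} = {a, b, c, d} \<longleftrightarrow>
     a \<in> {w,x,y,z} \<and> b \<in> {w,x,y,z} \<and> c \<in> {w,x,y,z} \<and> d \<in> {w,x,y,z} \<and> w \<in> {a,b,c,d} \<and> x \<in> {a,b,c,d}
      \<and> y \<in> {a,b,c,d} \<and> z \<in> {a,b,c,d}" for w x y z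
    by auto
  then show ?thesis
    unfolding cross_def using assms assms[symmetric]
    by (simp add: sum_nsets2_insert nsets2_empty mixed_self del: Un_insert_left Un_insert_right)
qed

lemma cross_triple:
  assumes "a \<noteq> b" "a \<noteq> c" "b \<noteq> c"
  shows "cross \<sigma> U {a, b, c} =
    mixed \<sigma> U {a, b} {a, c} + mixed \<sigma> U {a, c} {a, b} +
    mixed \<sigma> U {a, b} {b, c} + mixed \<sigma> U {b, c} {a, b} +
    mixed \<sigma> U {a, c} {b, c} + mixed \<sigma> U {b, c} {a, c}"
proof -
  have "{w, x} \<union> {y, z} = {a, b, c} \<longleftrightarrow>
     a \<in> {w,x,y,z} \<and> b \<in> {w,x,y,z} \<and> c \<in> {w,x,y,z} \<and> w \<in> {a,b,c} \<and> x \<in> {a,b,c}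
      \<and> y \<in> {a,b,c} \<and> z \<in> {a,b,c}" for w x y z
    by auto
  then show ?thesis
    unfolding cross_def using assms assms[symmetric]
    by (simp add: sum_nsets2_insert nsets2_empty mixed_self del: Un_insert_left Un_insert_right)
qed

text \<open>The four points have three perfect matchings. The two terms of a matching have an odd
  sum iff exactly one of its edges is in \<open>U\<close>, so modulo 2 they add up to the number of
  \<open>U\<close>-edges of \<open>F\<close>.\<close>

lemma even_cross_iff:
  assumes "F \<in> [V]\<^bsup>4\<^esup>"
  shows "even (cross (edge_sign E) U F) \<longleftrightarrow> even (\<Sum>e\<in>[F]\<^bsup>2\<^esup>. of_bool (e \<in> U) :: int)"
proof -
  obtain a b c d where F: "F = {a, b, c, d}" and d: "a \<noteq> b" "a \<noteq> c" "a \<noteq> d" "b \<noteq> c" "b \<noteq> d" "c \<noteq> d"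
    using assms by (auto simp: nsets_def numeral_eq_Suc card_Suc_eq)
  have "even (mixed (edge_sign E) U e f) \<longleftrightarrow> (e \<in> U \<longrightarrow> f \<in> U)" for e f
    by (simp add: mixed_def edge_sign_def)
  moreover have "even (of_bool P :: int) \<longleftrightarrow> \<not> P" for P
    by simp
  moreover have "(\<Sum>e\<in>[F]\<^bsup>2\<^esup>. of_bool (e \<in> U) :: int) = of_bool ({a, b} \<in> U) + of_bool ({a, c} \<in> U)
    + of_bool ({a, d} \<in> U) + of_bool ({b, c} \<in> U) + of_bool ({b, d} \<in> U) + of_bool ({c, d} \<in> U)"
    unfolding F using d by (simp add: sum_nsets2_insert nsets2_empty)
  ultimately show ?thesis
    unfolding F cross_quadruple[OF d]
    by (cases "{a, b} \<in> U"; cases "{a, c} \<in> U"; cases "{a, d} \<in> U";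
        cases "{b, c} \<in> U"; cases "{b, d} \<in> U"; cases "{c, d} \<in> U") simp_all
qed

text \<open>On a triple this is D(T) Q(T), and 4 D(T) Q(T) is the difference of the squares of D + Q
  and Q - D, the sign sums of \<open>E\<close> and \<open>E'\<close>. Such a square is 9 if the
  triple is homogeneous and 1 otherwise.\<close>

lemma cross_triple_eq_0:
  assumes T: "T \<in> [V]\<^bsup>3\<^esup>" and hom: "homogeneous E T \<longleftrightarrow> homogeneous E' T"
  shows "cross (edge_sign E) (sym_diff E E') T = 0"
proof -
  obtain a b c where F: "T = {a, b, c}" and d: "a \<noteq> b" "a \<noteq> c" "b \<noteq> c"
    using T by (auto simp: nsets_def numeral_eq_Suc card_Suc_eq)
  have T2: "[T]\<^bsup>2\<^esup> = {{a, b}, {a, c}, {b, c}}"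
    using d unfolding F by (auto elim!: nsets2_E)
  have "({a, b} \<in> E \<and> {a, c} \<in> E \<and> {b, c} \<in> E \<or> {a, b} \<notin> E \<and> {a, c} \<notin> E \<and> {b, c} \<notin> E) \<longleftrightarrow>
    ({a, b} \<in> E' \<and> {a, c} \<in> E' \<and> {b, c} \<in> E' \<or> {a, b} \<notin> E' \<and> {a, c} \<notin> E' \<and> {b, c} \<notin> E')"
    using hom unfolding homogeneous_def T2 by simp
  moreover have "mixed (edge_sign E) (sym_diff E E') e f =
     (if (e \<in> E \<longleftrightarrow> e \<in> E') \<or> (f \<in> E \<longleftrightarrow> f \<notin> E') then 0 else if e \<in> E \<longleftrightarrow> f \<in> E then 1 else -1)" for e f
    by (auto simp: mixed_def edge_sign_def)
  ultimately show ?thesis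
    unfolding F cross_triple[OF d]
    by (cases "{a, b} \<in> E"; cases "{a, c} \<in> E"; cases "{b, c} \<in> E";
        cases "{a, b} \<in> E'"; cases "{a, c} \<in> E'"; cases "{b, c} \<in> E'") simp_all
qed

subsection \<open>Parity conditions\<close>

text \<open>Comparing \<open>k\<close>-sets that share most of their points shows that any two pairs
  with a common point are both in \<open>U\<close> or both outside.\<close>

lemma even_edges_imp_constant:
  assumes V: "finite V" and k: "4 dvd k" "k > 0" "k + 2 \<le> card V"
    and even: "\<And>K. K \<in> [V]\<^bsup>k\<^esup> \<Longrightarrow> even (\<Sum>e\<in>[K]\<^bsup>2\<^esup>. of_bool (e \<in> U) :: int)"
  shows "[V]\<^bsup>2\<^esup> \<inter> U = {} \<or> [V]\<^bsup>2\<^esup> \<subseteq> U"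
proof -
  define u where "u K = (\<Sum>e\<in>[K]\<^bsup>2\<^esup>. of_bool (e \<in> U) :: int)" for K
  define h where "h x y = (of_bool ({x, y} \<in> U) :: int)" for x y
  have k4: "k \<ge> 4" using k dvd_imp_le by blast
  have u_insert: "u (insert x K) = u K + (\<Sum>z\<in>K. h x z)" if "finite K" "x \<notin> K" for x K
    using that by (simp add: u_def h_def sum_nsets2_insert)
  have even_u: "even (u K)" if "K \<subseteq> V" "card K = k" for K
    unfolding u_def using that V finite_subset by (intro even) (auto simp: nsets_def)
  \<comment> \<open>Add the parities of the four sets \<open>insert p (insert q L)\<close>:
    \<open>u L\<close> and the degrees into \<open>L\<close> occur an even number of times and
    cancel. The bound on \<open>k\<close> leaves \<open>k - 2\<close> points for
    \<open>L\<close>.\<close>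
  have four_cycle: "even (h x z + h y z + h x z' + h y z')"
    if d: "{x, y, z, z'} \<subseteq> V" "distinct [x, y, z, z']" for x y z z'
  proof -
    have "k - 2 \<le> card (V - {x, y, z, z'})"
      using d V k k4 by (simp add: card_Diff_subset)
    then obtain L where L: "L \<subseteq> V - {x, y, z, z'}" "card L = k - 2" "finite L"
      by (rule obtain_subset_with_card_n)
    have sum: "even (u L + (\<Sum>l\<in>L. h p l) + (\<Sum>l\<in>L. h q l) + h p q)"
      if "p \<in> {x, y}" "q \<in> {z, z'}" for p q
    proof -
      have "p \<notin> L" "q \<notin> L" "p \<noteq> q" "insert p (insert q L) \<subseteq> V" using that L d by auto
      then have "even (u (insert p (insert q L)))"
        using L k4 by (intro even_u) simp_all
      also have "u (insert p (insert q L)) = u L + (\<Sum>l\<in>L. h p l) + (\<Sum>l\<in>L. h q l) + h p q"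
        using \<open>p \<notin> L\<close> \<open>q \<notin> L\<close> \<open>p \<noteq> q\<close> L(3) by (simp add: u_insert)
      finally show ?thesis .
    qed
    have parity: "even (p + r + q + s)"
      if "even (w + a + c + p)" "even (w + a + d + q)" "even (w + b + c + r)" "even (w + b + d + s)"
      for w a b c d p q r s :: int
    proof -
      have "p + r + q + s = (w + a + c + p) + (w + a + d + q) + (w + b + c + r) + (w + b + d + s)
          - 2 * (2 * w + a + b + c + d)"
        by simp
      then show ?thesis using that by (metis dvd_add dvd_diff dvd_triv_left)
    qed
    show ?thesis
      by (rule parity[OF sum[of x z] sum[of x z'] sum[of y z] sum[of y z']]) simp_all
  qed
  \<comment> \<open>By \<open>four_cycle\<close>, \<open>h x l + h y l\<close> has the same parity
    for all \<open>l\<close> in a set \<open>L\<close> containing \<open>z\<close>. Comparing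
    \<open>insert x L\<close> with \<open>insert y L\<close> makes its sum over \<open>L\<close>
    even, and \<open>L\<close> has \<open>k - 1\<close> points, an odd number.\<close>
  have two_path: "{x, z} \<in> U \<longleftrightarrow> {y, z} \<in> U"
    if d: "{x, y, z} \<subseteq> V" "distinct [x, y, z]" for x y z
  proof -
    have "k - 2 \<le> card (V - {x, y, z})"
      using d V k k4 by (simp add: card_Diff_subset)
    then obtain M where M: "M \<subseteq> V - {x, y, z}" "card M = k - 2" "finite M"
      by (rule obtain_subset_with_card_n)
    define L where "L = insert z M"
    have "z \<notin> M" using M by auto
    then have L: "L \<subseteq> V - {x, y}" "card L = k - 1" "finite L"
      using M d k4 by (auto simp: L_def)
    have "even (h x l + h y l - (h x z + h y z))" if "l \<in> L" for l
    proof (cases "l = z")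
      case False
      then have "even (h x l + h y l + h x z + h y z)"
        using that d L by (intro four_cycle) auto
      then show ?thesis by (simp only: even_add even_diff) blast
    qed simp
    then have "even (\<Sum>l\<in>L. h x l + h y l - (h x z + h y z))"
      by (rule dvd_sum)
    also have "(\<Sum>l\<in>L. h x l + h y l - (h x z + h y z)) =
        (\<Sum>l\<in>L. h x l) + (\<Sum>l\<in>L. h y l) - int (k - 1) * (h x z + h y z)"
      using L by (simp add: sum_subtractf sum.distrib)
    finally have 1: "even ((\<Sum>l\<in>L. h x l) + (\<Sum>l\<in>L. h y l) - int (k - 1) * (h x z + h y z))" .
    have sum: "even (u L + (\<Sum>l\<in>L. h p l))" if "p \<in> {x, y}" for p
    proof -
      have "p \<notin> L" using that L by auto
      moreover have "even (u (insert p L))"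
        using L that d k4 \<open>p \<notin> L\<close> by (intro even_u) auto
      ultimately show ?thesis using L by (simp add: u_insert)
    qed
    have "even ((u L + (\<Sum>l\<in>L. h x l)) + (u L + (\<Sum>l\<in>L. h y l)))"
      by (intro dvd_add sum) simp_all
    then have "even ((\<Sum>l\<in>L. h x l) + (\<Sum>l\<in>L. h y l) + 2 * u L)"
      by (simp only: mult_2 add_ac)
    then have 2: "even ((\<Sum>l\<in>L. h x l) + (\<Sum>l\<in>L. h y l))"
      by simp
    have "even (int (k - 1) * (h x z + h y z))"
      using dvd_diff[OF 2 1] by (simp only: diff_diff_eq2 add_diff_cancel_left')
    moreover have "odd (int (k - 1))" using k k4 by auto
    ultimately have "even (h x z + h y z)" by (simp only: even_mult_iff) blast
    then show ?thesis by (auto simp: h_def of_bool_def split: if_splits)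
  qed
  show ?thesis
  proof (rule ccontr)
    assume "\<not> ?thesis"
    then obtain a b c d where ab: "{a, b} \<in> U" "a \<noteq> b" "a \<in> V" "b \<in> V"
      and cd: "{c, d} \<notin> U" "c \<noteq> d" "c \<in> V" "d \<in> V"
      by (auto elim!: nsets2_E)
    \<comment> \<open>One end of a pair in \<open>U\<close> may be moved freely, so the pair
      \<open>{c, d}\<close> is reached from \<open>{a, b}\<close>.\<close>
    have swap: "{p, r} \<in> U" if "{p, q} \<in> U" "p \<in> V" "q \<in> V" "r \<in> V" "p \<noteq> q" "p \<noteq> r" for p q r
      using that two_path[of q r p] by (cases "q = r") (auto simp: insert_commute)
    have ba: "{b, a} \<in> U" using ab by (simp add: insert_commute)
    show False
    proof (cases "c = a")
      case True
      then show ?thesis using swap[of a b d] ab cd by blast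
    next
      case False
      then have "{b, c} \<in> U \<or> c = b" using swap[OF ba] ab cd by blast
      then show ?thesis
      proof
        assume "{b, c} \<in> U"
        then have "b = c \<or> {c, d} \<in> U" using swap[of c b d] ab cd by (auto simp: insert_commute)
        then show ?thesis using swap[OF ba, of d] ab cd by auto
      next
        assume "c = b"
        then show ?thesis using swap[OF ba, of d] ab cd by auto
      qed
    qed
  qed
qed

lemma obtain_three_distinct:
  assumes "3 \<le> card A"
  obtains x y z where "{x, y, z} \<subseteq> A" "distinct [x, y, z]"
proof -
  obtain B where "B \<subseteq> A" "card B = 3" using obtain_subset_with_card_n[OF assms] by metis
  then obtain x y z where "{x, y, z} \<subseteq> A" "x \<noteq> y" "x \<noteq> z" "y \<noteq> z"
    by (auto simp: numeral_eq_Suc card_Suc_eq)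
  then show thesis using that by simp
qed

text \<open>By \<open>triple\<close>, every triple has an even number of \<open>U\<close>-edges.
  Three \<open>U\<close>-edges at one point would by \<open>star\<close> have pairwise different
  status in \<open>E\<close>, which is impossible. But given a \<open>U\<close>-edge, each of the at
  least five other points is joined in \<open>U\<close> to one of its ends, so one end gets three of
  them.\<close>

lemma even_triples_imp_empty:
  assumes V: "finite V" "7 \<le> card V"
    and triple: "\<And>x y z. {x, y, z} \<subseteq> V \<Longrightarrow> distinct [x, y, z] \<Longrightarrow>
      {x, y} \<in> U \<longleftrightarrow> ({x, z} \<in> U \<longleftrightarrow> {y, z} \<notin> U)"
    and star: "\<And>x y z. {x, y, z} \<subseteq> V \<Longrightarrow> distinct [x, y, z] \<Longrightarrow>
      {x, y} \<in> U \<Longrightarrow> {x, z} \<in> U \<Longrightarrow> {y, z} \<notin> U \<Longrightarrow> {x, y} \<in> E \<longleftrightarrow> {x, z} \<notin> E"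
  shows "[V]\<^bsup>2\<^esup> \<inter> U = {}"
proof (rule ccontr)
  assume "[V]\<^bsup>2\<^esup> \<inter> U \<noteq> {}"
  then obtain x y where xy: "x \<in> V" "y \<in> V" "x \<noteq> y" "{x, y} \<in> U"
    by (auto elim!: nsets2_E)
  have no_claw: False
    if p: "p \<in> V" and N: "N \<subseteq> V - {p}" "\<And>z. z \<in> N \<Longrightarrow> {p, z} \<in> U" "3 \<le> card N" for p N
  proof -
    obtain a b c where abc: "{a, b, c} \<subseteq> N" "distinct [a, b, c]"
      using N(3) by (rule obtain_three_distinct)
    have diff: "{p, q} \<in> E \<longleftrightarrow> {p, r} \<notin> E" if "q \<in> N" "r \<in> N" "q \<noteq> r" for q r
    proof -
      have pqr: "{p, q, r} \<subseteq> V" "distinct [p, q, r]" and "{p, q} \<in> U" "{p, r} \<in> U"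
        using that N(1,2) p by auto
      then show ?thesis using triple[OF pqr] star[OF pqr] by blast
    qed
    have "a \<in> N" "b \<in> N" "c \<in> N" "a \<noteq> b" "a \<noteq> c" "b \<noteq> c" using abc by auto
    then show False using diff by metis
  qed
  define A where "A = {z \<in> V - {x, y}. {x, z} \<in> U}"
  define B where "B = {z \<in> V - {x, y}. {y, z} \<in> U}"
  have "V - {x, y} = A \<union> B"
    using triple[of x y] xy by (auto simp: A_def B_def)
  moreover have "card (V - {x, y}) \<ge> 5"
    using V xy by (simp add: card_Diff_subset)
  ultimately have "5 \<le> card A + card B"
    using card_Un_le[of A B] by simp
  then have "3 \<le> card A \<or> 3 \<le> card B" by linarith
  moreover have "A \<subseteq> V - {x}" "B \<subseteq> V - {y}" by (auto simp: A_def B_def)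
  moreover have "{x, z} \<in> U" if "z \<in> A" for z using that by (simp add: A_def)
  moreover have "{y, z} \<in> U" if "z \<in> B" for z using that by (simp add: B_def)
  ultimately show False
    using no_claw[of x A] no_claw[of y B] xy by blast
qed

subsection \<open>Rigid pairs\<close>

text \<open>The total sign sums are D + Q for \<open>G\<close> and Q - D for \<open>G'\<close>. They
  agree up to sign, so D or Q is 0.\<close>

lemma iso_upto_compl_prod_eq_0:
  assumes K: "finite K" and iso: "iso_upto_compl (induced_graph G K) (induced_graph G' K)"
    and U: "U = sym_diff (snd G) (snd G')"
  shows "(\<Sum>e\<in>[K]\<^bsup>2\<^esup> \<inter> U. edge_sign (snd G) e) * (\<Sum>e\<in>[K]\<^bsup>2\<^esup> - U. edge_sign (snd G) e) = 0"
proof -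
  let ?s = "edge_sign (snd G)" and ?s' = "edge_sign (snd G')"
  obtain f c where f: "bij_betw f K K" and fc: "\<forall>e\<in>[K]\<^bsup>2\<^esup>. e \<in> snd G \<longleftrightarrow> (f ` e \<in> snd G' \<longleftrightarrow> c)"
    using iso unfolding iso_upto_compl_induced_iff by blast
  have fin: "finite ([K]\<^bsup>2\<^esup>)" using K by (rule finite_imp_finite_nsets)
  have "(\<Sum>e\<in>[K]\<^bsup>2\<^esup>. ?s' e) = (\<Sum>e\<in>[K]\<^bsup>2\<^esup>. ?s' (f ` e))"
    by (rule sum.reindex_bij_betw[OF bij_betw_nsets[OF f], symmetric])
  also have "\<dots> = (\<Sum>e\<in>[K]\<^bsup>2\<^esup>. (if c then 1 else -1) * ?s e)"
    using fc by (intro sum.cong) (auto simp: edge_sign_def)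
  also have "\<dots> = (if c then 1 else -1) * (\<Sum>e\<in>[K]\<^bsup>2\<^esup>. ?s e)"
    by (rule sum_distrib_left[symmetric])
  finally have "(\<Sum>e\<in>[K]\<^bsup>2\<^esup>. ?s' e) = (\<Sum>e\<in>[K]\<^bsup>2\<^esup>. ?s e) \<or>
      (\<Sum>e\<in>[K]\<^bsup>2\<^esup>. ?s' e) = - (\<Sum>e\<in>[K]\<^bsup>2\<^esup>. ?s e)"
    by auto
  moreover have "(\<Sum>e\<in>[K]\<^bsup>2\<^esup>. ?s e) = (\<Sum>e\<in>[K]\<^bsup>2\<^esup> \<inter> U. ?s e) + (\<Sum>e\<in>[K]\<^bsup>2\<^esup> - U. ?s e)"
    using fin by (rule sum.Int_Diff)
  moreover have "(\<Sum>e\<in>[K]\<^bsup>2\<^esup>. ?s' e) = (\<Sum>e\<in>[K]\<^bsup>2\<^esup> \<inter> U. ?s' e) + (\<Sum>e\<in>[K]\<^bsup>2\<^esup> - U. ?s' e)"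
    using fin by (rule sum.Int_Diff)
  moreover have "(\<Sum>e\<in>[K]\<^bsup>2\<^esup> \<inter> U. ?s' e) = - (\<Sum>e\<in>[K]\<^bsup>2\<^esup> \<inter> U. ?s e)"
    unfolding sum_negf[symmetric] by (rule sum.cong) (auto simp: U edge_sign_def)
  moreover have "(\<Sum>e\<in>[K]\<^bsup>2\<^esup> - U. ?s' e) = (\<Sum>e\<in>[K]\<^bsup>2\<^esup> - U. ?s e)"
    by (rule sum.cong) (auto simp: U edge_sign_def)
  ultimately show ?thesis by auto
qed

text \<open>Homogeneity is preserved by isomorphism and by complementation, so \<open>f\<close>
  permutes the \<open>n\<close>-sets compatibly with it.\<close>

lemma iso_upto_compl_homogeneous_sum:
  assumes iso: "iso_upto_compl (induced_graph G K) (induced_graph G' K)"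
  shows "(\<Sum>T\<in>[K]\<^bsup>n\<^esup>. of_bool (homogeneous (snd G) T) :: int) =
    (\<Sum>T\<in>[K]\<^bsup>n\<^esup>. of_bool (homogeneous (snd G') T))"
proof -
  obtain f c where f: "bij_betw f K K" and fc: "\<forall>e\<in>[K]\<^bsup>2\<^esup>. e \<in> snd G \<longleftrightarrow> (f ` e \<in> snd G' \<longleftrightarrow> c)"
    using iso unfolding iso_upto_compl_induced_iff by blast
  have hom: "homogeneous (snd G') (f ` T) \<longleftrightarrow> homogeneous (snd G) T" if "T \<in> [K]\<^bsup>n\<^esup>" for T
  proof -
    have sub: "T \<subseteq> K" using that by (simp add: nsets_def)
    then have "bij_betw f T (f ` T)"
      using f by (meson bij_betw_def inj_on_imp_bij_betw inj_on_subset)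
    then have "[f ` T]\<^bsup>2\<^esup> = (`) f ` [T]\<^bsup>2\<^esup>"
      using bij_betw_nsets by (metis bij_betw_imp_surj_on)
    moreover have "\<forall>e\<in>[T]\<^bsup>2\<^esup>. e \<in> snd G \<longleftrightarrow> (f ` e \<in> snd G' \<longleftrightarrow> c)"
      using fc nsets_mono[OF sub] by blast
    ultimately show ?thesis
      unfolding homogeneous_def by (cases c) auto
  qed
  have "(\<Sum>T\<in>[K]\<^bsup>n\<^esup>. of_bool (homogeneous (snd G') T) :: int) =
      (\<Sum>T\<in>[K]\<^bsup>n\<^esup>. of_bool (homogeneous (snd G') (f ` T)))"
    by (rule sum.reindex_bij_betw[OF bij_betw_nsets[OF f], symmetric])
  then show ?thesis using hom by simp
qed

section \<open>The Boolean sum of two hypomorphic graphs is empty or complete\<close>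

context
  fixes G G' :: "'a sgraph" and V :: "'a set" and U :: "'a set set" and k :: nat
  assumes V: "finite V" "fst G = V"
    and hyp: "hypomorphic_upto_compl k G G'"
    and U: "U = sym_diff (snd G) (snd G')"
begin

lemma iso_on:
  assumes "K \<in> [V]\<^bsup>k\<^esup>"
  shows "iso_upto_compl (induced_graph G K) (induced_graph G' K)"
  using assms hyp V by (simp add: hypomorphic_upto_compl_def)

text \<open>Each \<open>k\<close>-set contains equally many homogeneous triples of both graphs; the
  inclusion theorem for triples is applied to the difference of the indicators.\<close>

lemma homogeneous_triple_iff:
  assumes k: "3 \<le> k" "k + 3 \<le> card V" and T: "T \<in> [V]\<^bsup>3\<^esup>"
  shows "homogeneous (snd G) T \<longleftrightarrow> homogeneous (snd G') T"
proof -
  have "of_bool (homogeneous (snd G) T) - of_bool (homogeneous (snd G') T) = (0::int)"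
  proof (rule sum_nsets_eq_0_imp[OF V(1) k(1) _ _ T])
    fix K assume "K \<in> [V]\<^bsup>k\<^esup>"
    then show "(\<Sum>T\<in>[K]\<^bsup>3\<^esup>. of_bool (homogeneous (snd G) T) - of_bool (homogeneous (snd G') T)) = (0::int)"
      using iso_upto_compl_homogeneous_sum[OF iso_on] by (simp add: sum_subtractf del: sum_of_bool_eq)
  qed (use k in simp)
  then show ?thesis by (auto simp: of_bool_def split: if_splits)
qed

text \<open>If the two pairs at \<open>x\<close> had equal signs in \<open>G\<close>, they would
  have equal signs in \<open>G'\<close> too, while the sign of \<open>{y, z}\<close> relative to
  them changes. The triple would be homogeneous in exactly one of the graphs.\<close>

lemma star_signs_differ:
  assumes k: "3 \<le> k" "k + 3 \<le> card V"
    and xyz: "{x, y, z} \<subseteq> V" "distinct [x, y, z]"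
    and xy: "{x, y} \<in> U \<longleftrightarrow> {x, z} \<in> U" "{x, y} \<in> U \<longleftrightarrow> {y, z} \<notin> U"
  shows "{x, y} \<in> snd G \<longleftrightarrow> {x, z} \<notin> snd G"
proof -
  have "{x, y, z} \<in> [V]\<^bsup>3\<^esup>" using xyz by (simp add: nsets_def)
  then have "homogeneous (snd G) {x, y, z} \<longleftrightarrow> homogeneous (snd G') {x, y, z}"
    by (rule homogeneous_triple_iff[OF k])
  moreover have "[{x, y, z}]\<^bsup>2\<^esup> = {{x, y}, {x, z}, {y, z}}"
    using xyz(2) by (auto elim!: nsets2_E)
  ultimately show ?thesis
    using xy unfolding homogeneous_def U by auto
qed

lemma sum_cross_eq_0:
  assumes k: "3 \<le> k" "k + 3 \<le> card V" and K: "K \<in> [V]\<^bsup>k\<^esup>"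
  shows "(\<Sum>F\<in>[K]\<^bsup>4\<^esup>. cross (edge_sign (snd G)) U F) = 0"
proof -
  have fin: "finite K" "K \<subseteq> V" using K by (auto simp: nsets_def)
  have "(\<Sum>X\<in>Pow K. cross (edge_sign (snd G)) U X) = 0"
    using iso_upto_compl_prod_eq_0[OF fin(1) iso_on[OF K] U] prod_eq_sum_cross[OF fin(1)] by metis
  moreover have "cross (edge_sign (snd G)) U X = 0" if "X \<in> Pow K - [K]\<^bsup>4\<^esup>" for X
  proof (cases "card X = 3")
    case True
    then have "X \<in> [V]\<^bsup>3\<^esup>" using that fin finite_subset by (auto simp: nsets_def)
    then show ?thesis
      unfolding U using cross_triple_eq_0 homogeneous_triple_iff[OF k] by blast
  next
    case False
    then show ?thesis
      using that fin finite_subset by (intro cross_eq_0) (auto simp: nsets_def)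
  qed
  then have "(\<Sum>F\<in>[K]\<^bsup>4\<^esup>. cross (edge_sign (snd G)) U F) = (\<Sum>X\<in>Pow K. cross (edge_sign (snd G)) U X)"
    using fin by (intro sum.mono_neutral_left) (auto simp: nsets_def)
  ultimately show ?thesis by simp
qed

lemma sym_diff_constant_4_dvd:
  assumes k: "4 dvd k" "k > 0" "k + 2 \<le> card V"
  shows "[V]\<^bsup>2\<^esup> \<inter> U = {} \<or> [V]\<^bsup>2\<^esup> \<subseteq> U"
proof (rule even_edges_imp_constant[OF V(1) k])
  fix K assume K: "K \<in> [V]\<^bsup>k\<^esup>"
  have fin: "finite K" "card K = k" using K by (auto simp: nsets_def)
  have fin2: "finite ([K]\<^bsup>2\<^esup>)" using fin by (simp add: finite_imp_finite_nsets)
  \<comment> \<open>Signs are odd, so D and Q have the parities of the numbers of pairs inside and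
    outside \<open>U\<close>. One of these is even because D Q = 0, and their total
    \<open>k choose 2\<close> is even because 4 divides \<open>k\<close>.\<close>
  have parity: "even (\<Sum>e\<in>A. edge_sign (snd G) e) \<longleftrightarrow> even (card A)" if "finite A" for A
    using that by (induction A) (auto simp: edge_sign_def)
  have "even (card ([K]\<^bsup>2\<^esup>))"
    using k fin by (auto simp: choose_two elim!: dvdE)
  moreover have "card ([K]\<^bsup>2\<^esup>) = card ([K]\<^bsup>2\<^esup> \<inter> U) + card ([K]\<^bsup>2\<^esup> - U)"
    using fin2 by (metis card_Int_Diff)
  moreover have "even (card ([K]\<^bsup>2\<^esup> \<inter> U)) \<or> even (card ([K]\<^bsup>2\<^esup> - U))"
    using iso_upto_compl_prod_eq_0[OF fin(1) iso_on[OF K] U] fin2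
      parity[of "[K]\<^bsup>2\<^esup> \<inter> U"] parity[of "[K]\<^bsup>2\<^esup> - U"] by auto
  ultimately have "even (card ([K]\<^bsup>2\<^esup> \<inter> U))" by auto
  then show "even (\<Sum>e\<in>[K]\<^bsup>2\<^esup>. of_bool (e \<in> U) :: int)"
    using fin2 by (simp add: Int_def)
qed

lemma sym_diff_constant_small:
  assumes k: "4 \<le> k" "k + 4 \<le> card V"
  shows "[V]\<^bsup>2\<^esup> \<inter> U = {} \<or> [V]\<^bsup>2\<^esup> \<subseteq> U"
proof (rule even_edges_imp_constant[OF V(1), of 4])
  fix F assume F: "F \<in> [V]\<^bsup>4\<^esup>"
  have "cross (edge_sign (snd G)) U F = 0"
  proof (rule sum_nsets_eq_0_imp[OF V(1) k(1) _ _ F])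
    show "(\<Sum>F\<in>[K]\<^bsup>4\<^esup>. cross (edge_sign (snd G)) U F) = 0" if "K \<in> [V]\<^bsup>k\<^esup>" for K
      using that k by (intro sum_cross_eq_0) simp_all
  qed (use k in simp)
  then show "even (\<Sum>e\<in>[F]\<^bsup>2\<^esup>. of_bool (e \<in> U) :: int)"
    using even_cross_iff[OF F] by (metis dvd_0_right)
qed (use k in auto)

text \<open>Here the complements of triples are exactly the \<open>k\<close>-sets, so the vanishing
  sums over 4-subsets of \<open>k\<close>-sets are sums over 4-sets avoiding a triple.\<close>

lemma sum_cross_supersets_eq_0:
  assumes k: "4 \<le> k" "k + 3 = card V" and T: "T \<in> [V]\<^bsup>3\<^esup>"
  shows "(\<Sum>F | F \<in> [V]\<^bsup>4\<^esup> \<and> T \<subseteq> F. cross (edge_sign (snd G)) U F) = 0"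
proof (rule sum_supersets_eq_0[OF V(1) _ _ T])
  fix S assume "S \<in> [V]\<^bsup>3\<^esup>"
  then have "V - S \<in> [V]\<^bsup>k\<^esup>"
    using V k by (auto simp: nsets_def card_Diff_subset)
  then show "(\<Sum>F\<in>[V - S]\<^bsup>4\<^esup>. cross (edge_sign (snd G)) U F) = 0"
    using k by (intro sum_cross_eq_0) simp_all
qed (use k in simp)

text \<open>The 4-sets containing the triple arise by adding one of \<open>k\<close> further points,
  so modulo 2 their \<open>cross\<close> sum counts the edges within the triple \<open>k\<close>
  times, an odd number, and each edge leaving it once. The zero diagonal of \<open>h\<close> lets
  degree sums run over all of \<open>V\<close>.\<close>

lemma even_degree_sum:
  assumes k: "4 \<le> k" "k + 3 = card V" "odd k" and T: "{a, b, c} \<subseteq> V" "distinct [a, b, c]"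
  defines "h \<equiv> \<lambda>x y. of_bool (x \<noteq> y \<and> {x, y} \<in> U) :: int"
  shows "even (h a b + h a c + h b c + (\<Sum>x\<in>V. h a x) + (\<Sum>x\<in>V. h b x) + (\<Sum>x\<in>V. h c x))"
proof -
  let ?T = "{a, b, c}"
  define u where "u K = (\<Sum>e\<in>[K]\<^bsup>2\<^esup>. of_bool (e \<in> U) :: int)" for K
  have T3: "?T \<in> [V]\<^bsup>3\<^esup>" using T by (simp add: nsets_def)
  have h_comm: "h x y = h y x" for x y by (auto simp: h_def insert_commute)
  have h_self: "h x x = 0" for x by (simp add: h_def)
  have u_insert: "u (insert x K) = u K + (\<Sum>z\<in>K. h x z)" if "finite K" "x \<notin> K" for x K
  proof -
    have "(\<Sum>z\<in>K. of_bool ({x, z} \<in> U)) = (\<Sum>z\<in>K. h x z)"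
      unfolding h_def using that by (intro sum.cong) auto
    then show ?thesis unfolding u_def sum_nsets2_insert[OF that] by simp
  qed
  have "u {} = 0" by (simp add: u_def nsets2_empty)
  then have uT: "u ?T = h a b + h a c + h b c"
    using T(2) by (simp add: u_insert)
  have "{F. F \<in> [V]\<^bsup>4\<^esup> \<and> ?T \<subseteq> F} = (\<lambda>x. insert x ?T) ` (V - ?T)"
  proof (intro equalityI subsetI)
    fix F assume "F \<in> {F. F \<in> [V]\<^bsup>4\<^esup> \<and> ?T \<subseteq> F}"
    then have F: "F \<subseteq> V" "finite F" "card F = 4" "?T \<subseteq> F" by (auto simp: nsets_def)
    then have "card (F - ?T) = 1" using T(2) by (simp add: card_Diff_subset)
    then obtain x where "F - ?T = {x}" by (meson card_1_singletonE)
    then show "F \<in> (\<lambda>x. insert x ?T) ` (V - ?T)"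
      using F by (intro image_eqI[of _ _ x]) auto
  next
    fix F assume "F \<in> (\<lambda>x. insert x ?T) ` (V - ?T)"
    then show "F \<in> {F. F \<in> [V]\<^bsup>4\<^esup> \<and> ?T \<subseteq> F}"
      using T by (auto simp: nsets_def card_insert_if)
  qed
  moreover have "inj_on (\<lambda>x. insert x ?T) (V - ?T)"
    by (auto simp: inj_on_def)
  ultimately have "(\<Sum>x\<in>V - ?T. cross (edge_sign (snd G)) U (insert x ?T)) = 0"
    using sum_cross_supersets_eq_0[OF k(1,2) T3] by (simp add: sum.reindex)
  moreover have "even (u (insert x ?T) - cross (edge_sign (snd G)) U (insert x ?T))" if "x \<in> V - ?T" for x
  proof -
    have "insert x ?T \<in> [V]\<^bsup>4\<^esup>"
      using that T by (auto simp: nsets_def card_insert_if)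
    then show ?thesis using even_cross_iff unfolding u_def by (metis even_diff even_add)
  qed
  then have "even (\<Sum>x\<in>V - ?T. u (insert x ?T) - cross (edge_sign (snd G)) U (insert x ?T))"
    by (rule dvd_sum)
  ultimately have "even (\<Sum>x\<in>V - ?T. u (insert x ?T))"
    by (simp add: sum_subtractf)
  also have "(\<Sum>x\<in>V - ?T. u (insert x ?T)) = (\<Sum>x\<in>V - ?T. u ?T + (h a x + h b x + h c x))"
    using T(2) by (intro sum.cong) (simp_all add: u_insert h_comm)
  also have "\<dots> = int k * u ?T + (\<Sum>x\<in>V - ?T. h a x) + (\<Sum>x\<in>V - ?T. h b x) + (\<Sum>x\<in>V - ?T. h c x)"
    using T k(2)[symmetric] by (simp add: sum.distrib card_Diff_subset)
  finally have even: "even (u ?T + (\<Sum>x\<in>V - ?T. h a x) + (\<Sum>x\<in>V - ?T. h b x) + (\<Sum>x\<in>V - ?T. h c x))"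
    using k(3) by simp
  \<comment> \<open>Extending the three degree sums to the triple itself counts each of its pairs
    twice, which does not affect parity.\<close>
  have "(\<Sum>x\<in>V. h p x) = (\<Sum>x\<in>V - ?T. h p x) + (h p a + h p b + h p c)" for p
    using V(1) T by (subst sum.subset_diff[of ?T V]) auto
  moreover have "h b a = h a b" "h c a = h a c" "h c b = h b c" by (rule h_comm)+
  ultimately have "h a b + h a c + h b c + (\<Sum>x\<in>V. h a x) + (\<Sum>x\<in>V. h b x) + (\<Sum>x\<in>V. h c x) =
      (u ?T + (\<Sum>x\<in>V - ?T. h a x) + (\<Sum>x\<in>V - ?T. h b x) + (\<Sum>x\<in>V - ?T. h c x)) + 2 * u ?T"
    by (simp add: uT h_self)
  then show ?thesis using even by (simp only: even_add) simp
qed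

lemma sym_diff_constant_even:
  assumes k: "4 \<le> k" "k + 3 = card V" "odd k"
  shows "[V]\<^bsup>2\<^esup> \<inter> U = {} \<or> [V]\<^bsup>2\<^esup> \<subseteq> U"
proof -
  define h where "h x y = (of_bool (x \<noteq> y \<and> {x, y} \<in> U) :: int)" for x y
  define d where "d x = (\<Sum>y\<in>V. h x y)" for x
  have degree_sum: "even (h a b + h a c + h b c + d a + d b + d c)"
    if "{a, b, c} \<subseteq> V" "distinct [a, b, c]" for a b c
    using even_degree_sum[OF k that] by (simp add: d_def h_def)
  \<comment> \<open>In the sum over the four triples of \<open>{p, q, r, s}\<close> each pair occurs
    twice and each degree three times.\<close>
  have four: "even (d p + d q + d r + d s)"
    if "{p, q, r, s} \<subseteq> V" "distinct [p, q, r, s]" for p q r s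
  proof -
    have *: "even (u + v + w + x)"
      if "even (a + b + c + u + v + w)" "even (a + e + f + u + v + x)"
        "even (b + e + g + u + w + x)" "even (c + f + g + v + w + x)"
      for a b c e f g u v w x :: int
    proof -
      have "u + v + w + x = (a + b + c + u + v + w) + (a + e + f + u + v + x)
          + (b + e + g + u + w + x) + (c + f + g + v + w + x)
          - 2 * (a + b + c + e + f + g + u + v + w + x)"
        by simp
      then show ?thesis using that by (metis dvd_add dvd_diff dvd_triv_left)
    qed
    show ?thesis
      by (rule *[OF degree_sum[of p q r] degree_sum[of p q s] degree_sum[of p r s]
            degree_sum[of q r s]]) (use that in auto)
  qed
  \<comment> \<open>Exchanging one point in \<open>four\<close> compares two degrees.\<close>
  have same: "even (d p) \<longleftrightarrow> even (d q)" if "p \<in> V" "q \<in> V" for p q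
  proof (cases "p = q")
    case False
    then have "3 \<le> card (V - {p, q})" using that k V by (simp add: card_Diff_subset)
    then obtain x y z where "{x, y, z} \<subseteq> V - {p, q}" "distinct [x, y, z]"
      by (rule obtain_three_distinct)
    then have "even (d p + d x + d y + d z)" "even (d q + d x + d y + d z)"
      using that False by (intro four; auto)+
    then have "even ((d p + d x + d y + d z) + (d q + d x + d y + d z))"
      by (rule dvd_add)
    then have "even (d p + d q + 2 * (d x + d y + d z))"
      by (simp only: mult_2 add_ac)
    then show ?thesis by simp
  qed simp
  \<comment> \<open>The three degrees have the same parity, so their sum has the parity of
    \<open>d x\<close>.\<close>
  have triple: "even (h x y + h x z + h y z) \<longleftrightarrow> even (d x)"
    if "{x, y, z} \<subseteq> V" "distinct [x, y, z]" for x y z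
  proof -
    have "even (d x) \<longleftrightarrow> even (d y)" "even (d x) \<longleftrightarrow> even (d z)"
      using that by (auto intro!: same)
    then show ?thesis using degree_sum[OF that] by (simp only: even_add) blast
  qed
  have star: "{x, y} \<in> snd G \<longleftrightarrow> {x, z} \<notin> snd G"
    if "{x, y, z} \<subseteq> V" "distinct [x, y, z]"
      "{x, y} \<in> U \<longleftrightarrow> {x, z} \<in> U" "{x, y} \<in> U \<longleftrightarrow> {y, z} \<notin> U" for x y z
    using star_signs_differ[OF _ _ that] k by simp
  have V7: "7 \<le> card V" using k by simp
  show ?thesis
  proof (cases "\<forall>x\<in>V. even (d x)")
    case True
    have "[V]\<^bsup>2\<^esup> \<inter> U = {}"
    proof (rule even_triples_imp_empty[OF V(1) V7])
      fix x y z assume xyz: "{x, y, z} \<subseteq> V" "distinct [x, y, z]"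
      then show "{x, y} \<in> U \<longleftrightarrow> ({x, z} \<in> U \<longleftrightarrow> {y, z} \<notin> U)"
        using triple[OF xyz] True by (auto simp: h_def split: if_splits)
    next
      fix x y z assume "{x, y, z} \<subseteq> V" "distinct [x, y, z]"
        "{x, y} \<in> U" "{x, z} \<in> U" "{y, z} \<notin> U"
      then show "{x, y} \<in> snd G \<longleftrightarrow> {x, z} \<notin> snd G" by (intro star) blast+
    qed
    then show ?thesis ..
  next
    case False
    then have odd: "odd (d x)" if "x \<in> V" for x using same that by blast
    \<comment> \<open>An odd number of \<open>U\<close>-edges in every triple means an even number
      of non-edges; the condition for \<open>star\<close> is symmetric in \<open>U\<close> and its
      complement.\<close>
    have "[V]\<^bsup>2\<^esup> \<inter> - U = {}"
    proof (rule even_triples_imp_empty[OF V(1) V7])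
      fix x y z assume xyz: "{x, y, z} \<subseteq> V" "distinct [x, y, z]"
      then show "{x, y} \<in> - U \<longleftrightarrow> ({x, z} \<in> - U \<longleftrightarrow> {y, z} \<notin> - U)"
        using triple[OF xyz] odd by (auto simp: h_def split: if_splits)
    next
      fix x y z assume "{x, y, z} \<subseteq> V" "distinct [x, y, z]"
        "{x, y} \<in> - U" "{x, z} \<in> - U" "{y, z} \<notin> - U"
      then show "{x, y} \<in> snd G \<longleftrightarrow> {x, z} \<notin> snd G" by (intro star) blast+
    qed
    then show ?thesis by blast
  qed
qed

end

section \<open>From constant Boolean sums to rigid pairs\<close>

lemma hypomorphic_imp_eq_if_sym_diff_constant:
  assumes "\<And>G G'. fst G = V \<Longrightarrow> hypomorphic_upto_compl k G G' \<Longrightarrow>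
      [V]\<^bsup>2\<^esup> \<inter> sym_diff (snd G) (snd G') = {} \<or> [V]\<^bsup>2\<^esup> \<subseteq> sym_diff (snd G) (snd G')"
  shows "hypomorphic_imp_eq_upto_compl V k"
  unfolding hypomorphic_imp_eq_upto_compl_def
proof (intro allI impI, elim conjE)
  fix G G' :: "'a sgraph"
  assume G: "is_graph G" "is_graph G'" "fst G = V" "fst G' = V" "hypomorphic_upto_compl k G G'"
  have sub: "snd G \<subseteq> [V]\<^bsup>2\<^esup>" "snd G' \<subseteq> [V]\<^bsup>2\<^esup>"
    using G by (auto simp: is_graph_def)
  from assms[OF G(3,5)] have "snd G' = snd G \<or> snd G' = [V]\<^bsup>2\<^esup> - snd G"
  proof
    assume "[V]\<^bsup>2\<^esup> \<inter> sym_diff (snd G) (snd G') = {}"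
    then show ?thesis using sub by blast
  next
    assume "[V]\<^bsup>2\<^esup> \<subseteq> sym_diff (snd G) (snd G')"
    then show ?thesis using sub by blast
  qed
  then show "G' = G \<or> G' = graph_compl G"
    using G by (auto simp: graph_compl_def prod_eq_iff)
qed

lemma rigid_pairsI:
  assumes "4 dvd k \<and> k + 2 \<le> v \<or> k + 4 \<le> v \<or> odd k \<and> k + 3 = v" "4 \<le> k"
  shows "(v, k) \<in> rigid_pairs"
proof -
  have "hypomorphic_imp_eq_upto_compl V k" if V: "finite V" "card V = v" for V :: "nat set"
  proof (rule hypomorphic_imp_eq_if_sym_diff_constant)
    fix G G' :: "nat sgraph"
    assume "fst G = V" "hypomorphic_upto_compl k G G'"
    note * = V(1) this refl
    show "[V]\<^bsup>2\<^esup> \<inter> sym_diff (snd G) (snd G') = {} \<or> [V]\<^bsup>2\<^esup> \<subseteq> sym_diff (snd G) (snd G')"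
      using assms(1)
    proof (elim disjE conjE)
      assume "4 dvd k" "k + 2 \<le> v"
      then show ?thesis using sym_diff_constant_4_dvd[OF *] assms(2) V(2) by simp
    next
      assume "k + 4 \<le> v"
      then show ?thesis using sym_diff_constant_small[OF *] assms(2) V(2) by simp
    next
      assume "odd k" "k + 3 = v"
      then show ?thesis using sym_diff_constant_even[OF *] assms(2) V(2) by simp
    qed
  qed
  then show ?thesis by (auto simp: rigid_pairs_def)
qed

text \<open>There is at most one pair of vertices, so the Boolean sum is always empty or
  complete.\<close>

lemma rigid_pairs_le_2:
  assumes "v \<le> 2"
  shows "(v, k) \<in> rigid_pairs"
proof -
  have "hypomorphic_imp_eq_upto_compl V k" if V: "finite V" "card V = v" for V :: "nat set"
  proof -
    have "e = V" if "e \<in> [V]\<^bsup>2\<^esup>" for e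
      using that V assms card_seteq[of V e] by (auto simp: nsets_def)
    then have "[V]\<^bsup>2\<^esup> \<inter> U = {} \<or> [V]\<^bsup>2\<^esup> \<subseteq> U" for U
      by blast
    then show ?thesis
      by (rule hypomorphic_imp_eq_if_sym_diff_constant)
  qed
  then show ?thesis by (auto simp: rigid_pairs_def)
qed

subsection \<open>Counterexamples\<close>

text \<open>The 4-cycle of the Boolean sum consists of the points \<open>Inl 0, \<dots>, Inl 3\<close>. Its edges have odd
  sum \<open>i + j\<close>; the residue of this sum modulo 4 is 1 for \<open>01\<close> and \<open>23\<close>, which go to \<open>G\<close>, and 3 for
  \<open>12\<close> and \<open>03\<close>, which go to \<open>G'\<close>.\<close>

fun glued_adj :: "('b \<Rightarrow> 'b \<Rightarrow> bool) \<Rightarrow> nat \<Rightarrow> nat + 'b \<Rightarrow> nat + 'b \<Rightarrow> bool" where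
  "glued_adj R m (Inl i) (Inl j) \<longleftrightarrow> (i + j) mod 4 = m"
| "glued_adj R m (Inl i) (Inr y) \<longleftrightarrow> even i"
| "glued_adj R m (Inr x) (Inl j) \<longleftrightarrow> even j"
| "glued_adj R m (Inr x) (Inr y) \<longleftrightarrow> R x y"

definition glued_graph :: "('b \<Rightarrow> 'b \<Rightarrow> bool) \<Rightarrow> (nat + 'b) set \<Rightarrow> nat \<Rightarrow> (nat + 'b) sgraph" where
  "glued_graph R V m = (V, {{x, y} | x y. x \<in> V \<and> y \<in> V \<and> x \<noteq> y \<and> glued_adj R m x y})"

definition self_complementary_on :: "('b \<Rightarrow> 'b \<Rightarrow> bool) \<Rightarrow> 'b set \<Rightarrow> bool" where
  "self_complementary_on R X \<longleftrightarrow>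
    (\<exists>h. bij_betw h X X \<and> (\<forall>x\<in>X. \<forall>y\<in>X. x \<noteq> y \<longrightarrow> (R x y \<longleftrightarrow> \<not> R (h x) (h y))))"

lemma glued_adj_sym:
  assumes "symp R"
  shows "glued_adj R m x y \<longleftrightarrow> glued_adj R m y x"
  using assms by (cases x; cases y) (auto simp: add.commute dest: sympD)

lemma glued_graph_edge_iff:
  assumes "symp R"
  shows "{x, y} \<in> snd (glued_graph R V m) \<longleftrightarrow> x \<in> V \<and> y \<in> V \<and> x \<noteq> y \<and> glued_adj R m x y"
  using glued_adj_sym[OF assms] by (auto simp: glued_graph_def doubleton_eq_iff)

lemma is_graph_glued_graph: "is_graph (glued_graph R V m)"
  by (auto simp: is_graph_def glued_graph_def)

lemma fst_glued_graph: "fst (glued_graph R V m) = V"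
  by (simp add: glued_graph_def)

lemma bij_betw_map_sum_Plus:
  assumes "bij_betw g S S'" "bij_betw h X X'"
  shows "bij_betw (map_sum g h) (S <+> X) (S' <+> X')"
proof -
  have "inj_on (map_sum g h) (S <+> X)"
    using assms by (auto simp: bij_betw_def intro!: inj_onI dest: inj_onD)
  moreover have "map_sum g h ` (S <+> X) = (g ` S) <+> (h ` X)"
    by (simp add: Plus_def image_Un image_image)
  ultimately show ?thesis using assms by (simp add: bij_betw_def)
qed

lemma bij_betw_transposition:
  assumes "i \<in> S" "j \<in> S"
  shows "bij_betw (id(i := j, j := i)) S S"
  using assms by (intro bij_betwI[where g = "id(i := j, j := i)"]) auto

lemma glued_graph_iso:
  assumes R: "symp R" and K: "S <+> X \<subseteq> V"
    and bij: "bij_betw g S S" "bij_betw h X X"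
    and adj: "\<And>x y. x \<in> S <+> X \<Longrightarrow> y \<in> S <+> X \<Longrightarrow> x \<noteq> y \<Longrightarrow>
      glued_adj R m x y \<longleftrightarrow> (glued_adj R m' (map_sum g h x) (map_sum g h y) \<longleftrightarrow> c)"
  shows "iso_upto_compl (induced_graph (glued_graph R V m) (S <+> X))
    (induced_graph (glued_graph R V m') (S <+> X))"
  unfolding iso_upto_compl_induced_iff
proof (intro exI conjI)
  let ?f = "map_sum g h"
  show f: "bij_betw ?f (S <+> X) (S <+> X)"
    using bij by (rule bij_betw_map_sum_Plus)
  show "\<forall>e\<in>[S <+> X]\<^bsup>2\<^esup>. e \<in> snd (glued_graph R V m) \<longleftrightarrow> (?f ` e \<in> snd (glued_graph R V m') \<longleftrightarrow> c)"
    unfolding ball_nsets2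
  proof (intro ballI impI)
    fix x y assume xy: "x \<in> S <+> X" "y \<in> S <+> X" "x \<noteq> y"
    have "?f x \<in> S <+> X" "?f y \<in> S <+> X"
      using bij_betw_apply[OF f xy(1)] bij_betw_apply[OF f xy(2)] .
    note in_V = xy(1,2)[THEN subsetD[OF K]] this[THEN subsetD[OF K]]
    have "?f x \<noteq> ?f y"
      using inj_on_eq_iff[OF bij_betw_imp_inj_on[OF f] xy(1,2)] xy(3) by blast
    then have "{x, y} \<in> snd (glued_graph R V m) \<longleftrightarrow> glued_adj R m x y"
      "{?f x, ?f y} \<in> snd (glued_graph R V m') \<longleftrightarrow> glued_adj R m' (?f x) (?f y)"
      using xy(3) in_V by (simp_all add: glued_graph_edge_iff[OF R])
    then show "{x, y} \<in> snd (glued_graph R V m) \<longleftrightarrow>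
        (?f ` {x, y} \<in> snd (glued_graph R V m') \<longleftrightarrow> c)"
      using adj[OF xy] by simp
  qed
qed

text \<open>\<open>S\<close> and \<open>X\<close> are the cycle points and the points of the glued
  graph that a vertex subset retains; the map depends only on \<open>S\<close>.\<close>

lemma glued_graph_iso_upto_compl:
  assumes R: "symp R" and K: "S <+> X \<subseteq> V" and S: "S \<subseteq> {0, 1, 2, 3}"
    and compl: "card S = 2 \<Longrightarrow> self_complementary_on R X"
  shows "iso_upto_compl (induced_graph (glued_graph R V 1) (S <+> X))
    (induced_graph (glued_graph R V 3) (S <+> X))"
proof -
  have cases4: "i = 0 \<or> i = 1 \<or> i = 2 \<or> i = 3" if "i \<in> S" for i
    using that S by auto
  consider "S \<subseteq> {0, 2}" | "S \<subseteq> {1, 3}" | "{0, 2} \<subseteq> S" | "{1, 3} \<subseteq> S" |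
    i j where "S = {i, j}" "even i" "odd j"
  proof -
    have "S \<subseteq> {0, 2} \<or> S \<subseteq> {1, 3} \<or> {0, 2} \<subseteq> S \<or> {1, 3} \<subseteq> S \<or>
        S = {0, 1} \<or> S = {0, 3} \<or> S = {2, 1} \<or> S = {2, 3}"
      using S by blast
    then show thesis
      using that(1-4) that(5)[of 0 1] that(5)[of 0 3] that(5)[of 2 1] that(5)[of 2 3]
      by (elim disjE) simp_all
  qed
  then show ?thesis
  proof cases
    case 1
    \<comment> \<open>No edge of the cycle is left, so both induced graphs coincide; case 2 is
      alike.\<close>
    have "(i + j) mod 4 \<noteq> 1 \<and> (i + j) mod 4 \<noteq> 3" if "i \<in> S" "j \<in> S" for i j
    proof -
      have "even (i + j)" using 1 that by auto
      then show ?thesis by presburger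
    qed
    then show ?thesis
      by (intro glued_graph_iso[OF R K, of id id _ _ True]) (auto simp: sum.map_id)
  next
    case 2
    have "(i + j) mod 4 \<noteq> 1 \<and> (i + j) mod 4 \<noteq> 3" if "i \<in> S" "j \<in> S" for i j
    proof -
      have "even (i + j)" using 2 that by auto
      then show ?thesis by presburger
    qed
    then show ?thesis
      by (intro glued_graph_iso[OF R K, of id id _ _ True]) (auto simp: sum.map_id)
  next
    case 3
    \<comment> \<open>Exchanging opposite points sends each remaining cycle edge to one of the other
      class and keeps the attachment to \<open>X\<close>, which depends only on parity; likewise in
      case 4.\<close>
    define g where "g = id(0 := 2, 2 := 0 :: nat)"
    have g: "(i + j) mod 4 = 1 \<longleftrightarrow> (g i + g j) mod 4 = 3" if "i \<in> S" "j \<in> S" "i \<noteq> j" for i j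
      using cases4[OF that(1)] cases4[OF that(2)] that(3) by (elim disjE) (simp_all add: g_def)
    have even_g: "even (g i) \<longleftrightarrow> even i" for i
      by (simp add: g_def)
    show ?thesis
    proof (rule glued_graph_iso[OF R K])
      show "bij_betw g S S" using 3 unfolding g_def by (intro bij_betw_transposition) auto
      show "bij_betw id X X" by simp
      fix x y assume "x \<in> S <+> X" "y \<in> S <+> X" "x \<noteq> y"
      then show "glued_adj R 1 x y \<longleftrightarrow> (glued_adj R 3 (map_sum g id x) (map_sum g id y) \<longleftrightarrow> True)"
        by (elim PlusE; hypsubst) (use g even_g in auto)
    qed
  next
    case 4
    define g where "g = id(1 := 3, 3 := 1 :: nat)"
    have g: "(i + j) mod 4 = 1 \<longleftrightarrow> (g i + g j) mod 4 = 3" if "i \<in> S" "j \<in> S" "i \<noteq> j" for i j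
      using cases4[OF that(1)] cases4[OF that(2)] that(3) by (elim disjE) (simp_all add: g_def)
    have even_g: "even (g i) \<longleftrightarrow> even i" for i
      by (simp add: g_def)
    show ?thesis
    proof (rule glued_graph_iso[OF R K])
      show "bij_betw g S S" using 4 unfolding g_def by (intro bij_betw_transposition) auto
      show "bij_betw id X X" by simp
      fix x y assume "x \<in> S <+> X" "y \<in> S <+> X" "x \<noteq> y"
      then show "glued_adj R 1 x y \<longleftrightarrow> (glued_adj R 3 (map_sum g id x) (map_sum g id y) \<longleftrightarrow> True)"
        by (elim PlusE; hypsubst) (use g even_g in auto)
    qed
  next
    \<comment> \<open>One even and one odd point remain. Exchanging them swaps the point joined to
      all of \<open>X\<close> with the point joined to none, which complementation undoes; their own
      pair is an edge in exactly one of the graphs, and \<open>h\<close> complements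
      \<open>R\<close> on \<open>X\<close>.\<close>
    case (5 i j)
    then have "i \<noteq> j" by auto
    then have "card S = 2" using 5 by simp
    then obtain h where h: "bij_betw h X X"
      "\<And>x y. x \<in> X \<Longrightarrow> y \<in> X \<Longrightarrow> x \<noteq> y \<Longrightarrow> R x y \<longleftrightarrow> \<not> R (h x) (h y)"
      using compl unfolding self_complementary_on_def by blast
    show ?thesis
    proof (rule glued_graph_iso[OF R K])
      show "bij_betw (id(i := j, j := i)) S S" using 5 by (intro bij_betw_transposition) auto
      show "bij_betw h X X" by (fact h(1))
      fix x y assume xy: "x \<in> S <+> X" "y \<in> S <+> X" "x \<noteq> y"
      have "(i + j) mod 4 = 1 \<longleftrightarrow> (i + j) mod 4 \<noteq> 3" using 5(2,3) by presburger
      then show "glued_adj R 1 x y \<longleftrightarrow> (glued_adj R 3 (map_sum (id(i := j, j := i)) h x)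
          (map_sum (id(i := j, j := i)) h y) \<longleftrightarrow> False)"
        using xy h(2) 5 \<open>i \<noteq> j\<close> by (elim PlusE; hypsubst) (auto simp: add.commute)
    qed
  qed
qed

text \<open>The pair of cycle points 0 and 1 separates the two graphs, and \<open>third\<close>
  provides a pair at 0 on which they agree, so they are not complementary either.\<close>

lemma not_rigid_glued:
  assumes R: "symp R" and W: "finite W" and S: "S \<subseteq> {0, 1, 2, 3 :: nat}" "0 \<in> S" "1 \<in> S"
    and third: "2 \<in> S \<or> W \<noteq> {}"
    and compl: "\<And>X. X \<subseteq> W \<Longrightarrow> card X + 2 = k \<Longrightarrow> self_complementary_on R X"
  shows "(card S + card W, k) \<notin> rigid_pairs"
proof -
  let ?V = "S <+> W"
  let ?G = "glued_graph R ?V 1" and ?G' = "glued_graph R ?V 3"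
  have finS: "finite S" using S finite_subset by blast
  then have V: "finite ?V" "card ?V = card S + card W"
    using W by (auto simp: card_Plus)
  have "hypomorphic_upto_compl k ?G ?G'"
    unfolding hypomorphic_upto_compl_def fst_glued_graph
  proof
    fix K assume "K \<in> [?V]\<^bsup>k\<^esup>"
    then have K: "K \<subseteq> ?V" "card K = k" by (auto simp: nsets_def)
    define A where "A = Inl -` K"
    define X where "X = Inr -` K"
    have AX: "K = A <+> X"
      using K by (auto simp: A_def X_def)
    have sub: "A \<subseteq> S" "X \<subseteq> W" using K by (auto simp: A_def X_def)
    then have "card K = card A + card X"
      using finS W finite_subset unfolding AX by (metis card_Plus)
    then show "iso_upto_compl (induced_graph ?G K) (induced_graph ?G' K)"
      unfolding AX using sub K S unfolding AX
      by (intro glued_graph_iso_upto_compl R compl) auto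
  qed
  moreover have "?G' \<noteq> ?G"
  proof -
    have "{Inl 0, Inl 1} \<in> snd ?G" "{Inl 0, Inl 1} \<notin> snd ?G'"
      using S by (simp_all add: glued_graph_edge_iff[OF R] InlI)
    then show ?thesis by metis
  qed
  moreover have "?G' \<noteq> graph_compl ?G"
  proof -
    obtain z where z: "z \<in> ?V" "z \<noteq> Inl 0" "glued_adj R 3 (Inl 0) z \<longleftrightarrow> glued_adj R 1 (Inl 0) z"
    proof (cases "2 \<in> S")
      case True
      then show thesis using that[of "Inl 2"] by auto
    next
      case False
      then show thesis using that third by fastforce
    qed
    then have "{Inl 0, z} \<in> [?V]\<^bsup>2\<^esup>" "{Inl 0, z} \<in> snd ?G \<longleftrightarrow> {Inl 0, z} \<in> snd ?G'"
      using S by (auto simp: glued_graph_edge_iff[OF R])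
    then show ?thesis
      by (auto simp: graph_compl_def fst_glued_graph)
  qed
  ultimately have "\<not> hypomorphic_imp_eq_upto_compl ?V k"
    unfolding hypomorphic_imp_eq_upto_compl_def
    using is_graph_glued_graph fst_glued_graph by blast
  then show ?thesis using rigid_pairs_iff[OF V] by blast
qed

lemma not_rigid_outside:
  assumes v: "2 < v" and k: "k < 4 \<or> v - 2 < k"
  shows "(v, k) \<notin> rigid_pairs"
proof -
  define R where "R = (\<lambda>(_ :: nat) (_ :: nat). False)"
  have R: "symp R" by (simp add: R_def symp_def)
  show ?thesis
  proof (cases "k < 4 \<or> v < k")
    case True
    have nonempty: "{..<v - 2} \<noteq> {}"
      using v by (metis lessThan_iff empty_iff zero_less_diff)
    \<comment> \<open>For \<open>k < 4\<close> the set \<open>X\<close> has at most one point and is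
      trivially self-complementary; for \<open>v < k\<close> there is no such
      \<open>X\<close>.\<close>
    have "(card {0, 1 :: nat} + card {..<v - 2}, k) \<notin> rigid_pairs"
    proof (rule not_rigid_glued[OF R])
      fix X assume X: "X \<subseteq> {..<v - 2}" "card X + 2 = k"
      then have "card X \<le> v - 2" using card_mono[of "{..<v - 2}" X] by simp
      then have "card X \<le> 1" using True X v by auto
      moreover have "finite X" using X(1) finite_subset by blast
      ultimately have "x = y" if "x \<in> X" "y \<in> X" for x y
        using that by (metis card_le_Suc0_iff_eq One_nat_def)
      then show "self_complementary_on R X"
        unfolding self_complementary_on_def by (intro exI[of _ id]) auto
    qed (use nonempty in auto)
    moreover have "card {0, 1 :: nat} + card {..<v - 2} = v" using v by simp
    ultimately show ?thesis by metis
  next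
    case False
    \<comment> \<open>Here \<open>k\<close> is \<open>v - 1\<close> or \<open>v\<close>, so
      \<open>X\<close> would need more than the \<open>v - 4\<close> available points: every
      \<open>k\<close>-set contains at least three cycle points.\<close>
    have "(card {0, 1, 2, 3 :: nat} + card {..<v - 4}, k) \<notin> rigid_pairs"
    proof (rule not_rigid_glued[OF R])
      fix X assume X: "X \<subseteq> {..<v - 4}" "card X + 2 = k"
      then have "card X \<le> v - 4" using card_mono[of "{..<v - 4}" X] by simp
      then show "self_complementary_on R X" using X False k by auto
    qed auto
    moreover have "card {0, 1, 2, 3 :: nat} + card {..<v - 4} = v" using False by auto
    ultimately show ?thesis by metis
  qed
qed

text \<open>Lexicographic powers of the 5-cycle. The map \<open>x \<mapsto> 2x - w\<close> of the integers modulo 5 fixes \<open>w\<close> and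
  exchanges the 5-cycle with its complement, so applying it to each letter of a word shows that the
  power remains self-complementary after deletion of any vertex.\<close>

fun pentagon_lex :: "int list \<Rightarrow> int list \<Rightarrow> bool" where
  "pentagon_lex (a # as) (b # bs) \<longleftrightarrow> (if a = b then pentagon_lex as bs else (a - b) mod 5 \<in> {1, 4})"
| "pentagon_lex _ _ \<longleftrightarrow> False"

definition words :: "nat \<Rightarrow> int list set" where
  "words n = {xs. set xs \<subseteq> {0..<5} \<and> length xs = n}"

definition dilate :: "int list \<Rightarrow> int list \<Rightarrow> int list" where
  "dilate ws xs = map2 (\<lambda>w x. (2 * x - w) mod 5) ws xs"

lemma finite_words: "finite (words n)"
  unfolding words_def by (rule finite_lists_length_eq) simp

lemma card_words: "card (words n) = 5 ^ n"
  unfolding words_def by (subst card_lists_length_eq) simp_all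

lemma symp_pentagon_lex: "symp pentagon_lex"
proof (rule sympI)
  fix xs ys assume "pentagon_lex xs ys"
  then show "pentagon_lex ys xs"
  proof (induction xs ys rule: pentagon_lex.induct)
    case (1 a as b bs)
    have "(b - a) mod 5 \<in> {1, 4}" if "(a - b) mod 5 \<in> {1, 4}"
      using that by auto presburger+
    then show ?case using 1 by (auto split: if_splits)
  qed simp_all
qed

text \<open>2 is invertible modulo 5.\<close>

lemma dilate_digit_eq_iff:
  assumes "a \<in> {0..<5}" "b \<in> {0..<5::int}"
  shows "(2 * a - w) mod 5 = (2 * b - w) mod 5 \<longleftrightarrow> a = b"
proof
  assume "(2 * a - w) mod 5 = (2 * b - w) mod 5"
  then have "5 dvd 2 * (a - b)"
    by (simp add: mod_eq_dvd_iff right_diff_distrib)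
  then have "5 dvd a - b" by presburger
  then have "a - b = 0 \<or> 5 \<le> \<bar>a - b\<bar>"
    using dvd_imp_le_int[of "a - b" 5] by auto
  then show "a = b" using assms by auto
qed simp

text \<open>Doubling exchanges the residues 1, 4 with the residues 2, 3 modulo 5, and the shift by
  \<open>w\<close> cancels in the difference.\<close>

lemma dilate_digit_diff:
  fixes a b w :: int
  assumes "\<not> 5 dvd a - b"
  shows "((2 * a - w) mod 5 - (2 * b - w) mod 5) mod 5 \<in> {1, 4} \<longleftrightarrow> (a - b) mod 5 \<notin> {1, 4}"
proof -
  have eq: "((2 * a - w) mod 5 - (2 * b - w) mod 5) mod 5 = (2 * (a - b)) mod 5"
    by (simp add: mod_diff_eq right_diff_distrib)
  have "(2 * d) mod 5 \<in> {1, 4} \<longleftrightarrow> d mod 5 \<notin> {1, 4}" if "\<not> 5 dvd d" for d :: int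
    using that by simp presburger
  then show ?thesis unfolding eq using assms by blast
qed

lemma dilate_in_words:
  assumes "ws \<in> words n" "xs \<in> words n"
  shows "dilate ws xs \<in> words n"
  using assms by (auto simp: words_def dilate_def set_zip)

lemma dilate_eq_iff:
  assumes "ws \<in> words n" "xs \<in> words n" "ys \<in> words n"
  shows "dilate ws xs = dilate ws ys \<longleftrightarrow> xs = ys"
proof -
  have "length ws = length xs" "length xs = length ys" "set xs \<subseteq> {0..<5}" "set ys \<subseteq> {0..<5}"
    using assms by (auto simp: words_def)
  then show ?thesis
    by (induction ws xs ys rule: list_induct3) (simp_all add: dilate_def dilate_digit_eq_iff)
qed

lemma dilate_self:
  assumes "ws \<in> words n"
  shows "dilate ws ws = ws"
proof -
  have "set ws \<subseteq> {0..<5}" using assms by (simp add: words_def)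
  then show ?thesis
    by (induction ws) (simp_all add: dilate_def)
qed

text \<open>Adjacency is decided at the first position where the words differ, and
  \<open>dilate\<close> acts injectively on each letter, so this position is kept.\<close>

lemma pentagon_lex_dilate:
  assumes "ws \<in> words n" "xs \<in> words n" "ys \<in> words n" "xs \<noteq> ys"
  shows "pentagon_lex (dilate ws xs) (dilate ws ys) \<longleftrightarrow> \<not> pentagon_lex xs ys"
proof -
  have "length ws = length xs" "length xs = length ys" "set xs \<subseteq> {0..<5}" "set ys \<subseteq> {0..<5}"
    using assms by (auto simp: words_def)
  then show ?thesis using assms(4)
  proof (induction ws xs ys rule: list_induct3)
    case (Cons w ws a xs b ys)
    have "\<not> 5 dvd a - b" if "a \<noteq> b"
      using that Cons.prems dvd_imp_le_int[of "a - b" 5] by auto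
    then show ?case
      using Cons dilate_digit_eq_iff[of a b w] dilate_digit_diff[of a b w]
      by (cases "a = b") (simp_all add: dilate_def)
  qed simp
qed

lemma self_complementary_words_Diff:
  assumes "w \<in> words n" "A \<subseteq> {w}"
  shows "self_complementary_on pentagon_lex (words n - A)"
  unfolding self_complementary_on_def
proof (intro exI conjI ballI impI)
  have inj: "inj_on (dilate w) (words n - A)"
    using dilate_eq_iff[OF assms(1)] by (auto simp: inj_on_def)
  moreover have "dilate w x \<in> words n - A" if "x \<in> words n - A" for x
    using that dilate_in_words[OF assms(1)] dilate_eq_iff[OF assms(1) _ assms(1)]
      dilate_self[OF assms(1)] assms(2) by fastforce
  ultimately show "bij_betw (dilate w) (words n - A) (words n - A)"
    using finite_words by (intro bij_betw_imageI endo_inj_surj) auto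
qed (use pentagon_lex_dilate[OF assms(1)] in auto)

lemma self_complementary_words_subset:
  assumes X: "X \<subseteq> words n" "5 ^ n \<le> card X + 1"
  shows "self_complementary_on pentagon_lex X"
proof -
  have "card (words n - X) \<le> 1"
    using X finite_words finite_subset[OF X(1) finite_words]
    by (simp add: card_Diff_subset card_words)
  then have one: "x = y" if "x \<in> words n - X" "y \<in> words n - X" for x y
    using that finite_words by (metis card_le_Suc0_iff_eq One_nat_def finite_Diff)
  \<comment> \<open>If no word is missing from \<open>X\<close>, any word may serve as the fixed
    point.\<close>
  have "replicate n 0 \<in> words n" by (auto simp: words_def)
  then obtain w where "w \<in> words n" "words n - X \<subseteq> {w}"
    using one by (cases "words n - X = {}") blast+
  then have "self_complementary_on pentagon_lex (words n - (words n - X))"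
    by (rule self_complementary_words_Diff)
  then show ?thesis using X(1) by (simp add: double_diff)
qed

text \<open>With two cycle points in a \<open>k\<close>-set, \<open>k - 2 \<ge> 5 ^ n - 1\<close>
  words remain, so at most one word is deleted. For \<open>c = 3\<close> the cycle loses the point
  3.\<close>

lemma not_rigid_words:
  assumes c: "c = 3 \<or> c = 4" and k: "5 ^ n + 1 \<le> k"
  shows "(5 ^ n + c, k) \<notin> rigid_pairs"
proof -
  have "card {0, 1, 2 :: nat} = 3" "card {0, 1, 2, 3 :: nat} = 4" by simp_all
  then obtain S :: "nat set" where S: "S = {0, 1, 2} \<or> S = {0, 1, 2, 3}" "card S = c"
    using c by metis
  have "(card S + card (words n), k) \<notin> rigid_pairs"
    by (rule not_rigid_glued[OF symp_pentagon_lex finite_words])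
      (use S k in \<open>auto intro: self_complementary_words_subset\<close>)
  then show ?thesis by (simp add: S card_words add.commute)
qed

section \<open>Powers of five and the case distinction on \<open>v\<close> modulo 4\<close>

lemma five_power_mod_4: "5 ^ n mod 4 = (1 :: nat)"
  by (induction n) (simp_all add: mod_mult_right_eq[symmetric] del: mod_mult_right_eq)

lemma infinite_of_five_powers:
  assumes "\<And>n. P (5 ^ n + c :: nat)"
  shows "infinite {v. P v}"
proof -
  have "inj (\<lambda>n. 5 ^ n + c :: nat)"
    by (auto simp: inj_def)
  then have "infinite (range (\<lambda>n. 5 ^ n + c :: nat))"
    by (rule range_inj_infinite)
  then show ?thesis
    using assms by (elim infinite_super[rotated]) auto
qed

theorem theorem1p1:
  shows "(\<forall>v k. v \<le> 2 \<longrightarrow> (v, k) \<in> rigid_pairs) \<and>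
    (\<forall>v k. v > 2 \<longrightarrow> (v, k) \<in> rigid_pairs \<longrightarrow> 4 \<le> k \<and> k \<le> v - 2) \<and>
    (\<forall>v k. v > 2 \<longrightarrow> v mod 4 = 2 \<longrightarrow> ((v, k) \<in> rigid_pairs \<longleftrightarrow> 4 \<le> k \<and> k \<le> v - 2)) \<and>
    (\<forall>v k. v > 2 \<longrightarrow> v mod 4 = 0 \<or> v mod 4 = 3 \<longrightarrow> 4 \<le> k \<and> k \<le> v - 3 \<longrightarrow> (v, k) \<in> rigid_pairs) \<and>
    infinite {v. v > 2 \<and> (v mod 4 = 0 \<or> v mod 4 = 3) \<and>
      (\<forall>k. (v, k) \<in> rigid_pairs \<longrightarrow> k \<le> v - 3)} \<and>
    (\<forall>v k. v > 2 \<longrightarrow> v mod 4 = 1 \<longrightarrow> 4 \<le> k \<and> k \<le> v - 4 \<longrightarrow> (v, k) \<in> rigid_pairs) \<and>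
    infinite {v. v > 2 \<and> v mod 4 = 1 \<and> (\<forall>k. (v, k) \<in> rigid_pairs \<longrightarrow> k \<le> v - 4)}"
proof (intro conjI allI impI)
  fix v k :: nat
  assume "v \<le> 2"
  then show "(v, k) \<in> rigid_pairs" by (rule rigid_pairs_le_2)
next
  fix v k :: nat
  assume "v > 2" "(v, k) \<in> rigid_pairs"
  then show "4 \<le> k" "k \<le> v - 2"
    using not_rigid_outside[of v k] by linarith+
next
  fix v k :: nat
  assume v: "v > 2" "v mod 4 = 2"
  show "(v, k) \<in> rigid_pairs \<longleftrightarrow> 4 \<le> k \<and> k \<le> v - 2"
  proof
    assume "(v, k) \<in> rigid_pairs"
    then show "4 \<le> k \<and> k \<le> v - 2"
      using not_rigid_outside[of v k] v by linarith
  next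
    assume "4 \<le> k \<and> k \<le> v - 2"
    \<comment> \<open>For \<open>v\<close> congruent to 2, the value \<open>v - 2\<close> is
      divisible by 4 and \<open>v - 3\<close> is odd.\<close>
    then have "4 \<le> k" "k + 2 = v \<or> k + 3 = v \<or> k + 4 \<le> v" by auto
    then show "(v, k) \<in> rigid_pairs"
      using v by (intro rigid_pairsI) presburger+
  qed
next
  fix v k :: nat
  assume v: "v > 2" "v mod 4 = 0 \<or> v mod 4 = 3" and k: "4 \<le> k \<and> k \<le> v - 3"
  \<comment> \<open>The value \<open>v - 3\<close> is odd if \<open>v\<close> is congruent to 0, and
    divisible by 4 if \<open>v\<close> is congruent to 3.\<close>
  then have "4 \<le> k" "k + 3 = v \<or> k + 4 \<le> v" by auto
  then show "(v, k) \<in> rigid_pairs"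
    using v by (intro rigid_pairsI) presburger+
next
  fix v k :: nat
  assume "v > 2" "v mod 4 = 1" "4 \<le> k \<and> k \<le> v - 4"
  then show "(v, k) \<in> rigid_pairs"
    by (intro rigid_pairsI) auto
next
  show "infinite {v. v > 2 \<and> (v mod 4 = 0 \<or> v mod 4 = 3) \<and>
      (\<forall>k. (v, k) \<in> rigid_pairs \<longrightarrow> k \<le> v - 3)}"
  proof (rule infinite_of_five_powers[where c = 3])
    fix n
    have "k \<le> 5 ^ n" if "(5 ^ n + 3, k) \<in> rigid_pairs" for k
      using not_rigid_words[of 3 n k] that by (cases "5 ^ n + 1 \<le> k") simp_all
    moreover have "(5 ^ n + 3) mod 4 = (0 :: nat)"
      using five_power_mod_4[of n] by presburger
    ultimately show "2 < (5 ^ n + 3 :: nat) \<and> ((5 ^ n + 3 :: nat) mod 4 = 0 \<or> (5 ^ n + 3 :: nat) mod 4 = 3) \<and>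
        (\<forall>k. (5 ^ n + 3, k) \<in> rigid_pairs \<longrightarrow> k \<le> 5 ^ n + 3 - 3)"
      by simp
  qed
next
  show "infinite {v. v > 2 \<and> v mod 4 = 1 \<and> (\<forall>k. (v, k) \<in> rigid_pairs \<longrightarrow> k \<le> v - 4)}"
  proof (rule infinite_of_five_powers[where c = 4])
    fix n
    have "k \<le> 5 ^ n" if "(5 ^ n + 4, k) \<in> rigid_pairs" for k
      using not_rigid_words[of 4 n k] that by (cases "5 ^ n + 1 \<le> k") simp_all
    moreover have "(5 ^ n + 4) mod 4 = (1 :: nat)"
      using five_power_mod_4[of n] by presburger
    ultimately show "2 < (5 ^ n + 4 :: nat) \<and> (5 ^ n + 4 :: nat) mod 4 = 1 \<and>
        (\<forall>k. (5 ^ n + 4, k) \<in> rigid_pairs \<longrightarrow> k \<le> 5 ^ n + 4 - 4)"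
      by simp
  qed
qed

end
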